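(* Let $\Phi=(A;\{E_i\}_{i=0}^d;A^*;\{E^*_i\}_{i=0}^d)$ be a Leonard system in $\mathcal{A}$ with parameter array $(\{\theta_i\}_{i=0}^d;\{\theta^*_i\}_{i=0}^d;\{\varphi_i\}_{i=1}^d;\{\phi_i\}_{i=1}^d)$, and let $\xi_0\in E_0V$, $\xi_d\in E_dV$, $\xi^*_0\in E^*_0V$, $\xi^*_d\in E^*_dV$ be nonzero vectors. Then (i) and (ii) hold. (i) Let $\{X_i\}_{i=0}^d$ denote one of the sequences $\{E_i\}_{i=0}^d$, $\{E_{d-i}\}_{i=0}^d$, $\{\tau_i(A)\}_{i=0}^d$, $\{\tau_{d-i}(A)\}_{i=0}^d$, $\{\eta_i(A)\}_{i=0}^d$, $\{\eta_{d-i}(A)\}_{i=0}^d$. Then for $0\le i\le d$, \begin{align*} \frac{\eta_d(\theta_0)}{\phi}\frac{\langle\xi^*_0,\xi^*_0\rangle}{\langle\xi_d,\xi^*_0\rangle}\sum_{r=0}^dX_rE^*_0E_0\tau^*_{d-r}(A^* )\cdot\eta^*_i(A^* )\xi_d &= X_i\xi^*_0,\\ \frac{\langle\xi^*_d,\xi^*_d\rangle}{\langle\xi_d,\xi^*_d\rangle}\sum_{r=0}^d\frac{X_rE^*_d\eta_r(A)}{\varphi_d\varphi_{d-1}\cdots\varphi_{d-r+1}}\cdot\eta^*_i(A^* )\xi_d &= X_i\xi^*_d,\\ \frac{\eta_d(\theta_0)}{\phi}\frac{\langle\xi^*_0,\xi^*_0\rangle}{\langle\xi_d,\xi^*_0\rangle}\sum_{r=0}^dX_{d-r}E^*_0E_0\tau^*_{d-r}(A^*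 )\cdot\eta^*_{d-i}(A^* )\xi_d &= X_i\xi^*_0,\\ \frac{\langle\xi^*_d,\xi^*_d\rangle}{\langle\xi_d,\xi^*_d\rangle}\sum_{r=0}^d\frac{X_{d-r}E^*_d\eta_r(A)}{\varphi_d\varphi_{d-1}\cdots\varphi_{d-r+1}}\cdot\eta^*_{d-i}(A^* )\xi_d &= X_i\xi^*_d. \end{align*} (ii) Let $\{X_i\}_{i=0}^d$ denote one of the sequences $\{E^*_i\}_{i=0}^d$, $\{E^*_{d-i}\}_{i=0}^d$, $\{\tau^*_i(A^* )\}_{i=0}^d$, $\{\tau^*_{d-i}(A^* )\}_{i=0}^d$, $\{\eta^*_i(A^* )\}_{i=0}^d$, $\{\eta^*_{d-i}(A^* )\}_{i=0}^d$. Then for $0\le i\le d$, \begin{align*} \frac{\eta_d(\theta_0)}{\varphi}\frac{\langle\xi_0,\xi^*_d\rangle}{\langle\xi_d,\xi^*_d\rangle}\sum_{r=0}^dX_rE_0\tau^*_{d-r}(A^* )\cdot\eta^*_i(A^* )\xi_d &= X_i\xi_0,\\ \frac{1}{\mathrm{tr}(E_dE^*_d)}\sum_{r=0}^d\frac{X_rE_dE^*_d\eta_r(A)}{\varphi_d\varphi_{d-1}\cdots\varphi_{d-r+1}}\cdot\eta^*_i(A^* )\xi_d &= X_i\xi_d,\\ \frac{\eta_d(\theta_0)}{\varphi}\frac{\langle\xi_0,\xi^*_d\rangle}{\langle\xi_d,\xi^*_d\rangle}\sum_{r=0}^dX_{d-r}E_0\tau^*_{d-r}(A^* )\cdot\eta^*_{d-i}(A^*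 )\xi_d &= X_i\xi_0,\\ \frac{1}{\mathrm{tr}(E_dE^*_d)}\sum_{r=0}^d\frac{X_{d-r}E_dE^*_d\eta_r(A)}{\varphi_d\varphi_{d-1}\cdots\varphi_{d-r+1}}\cdot\eta^*_{d-i}(A^* )\xi_d &= X_i\xi_d. \end{align*}
   Context: Let $\mathbb{K}$ be a field, $d\ge 0$ an integer, $\mathcal{A}$ a $\mathbb{K}$-algebra isomorphic to the algebra $\mathrm{Mat}_{d+1}(\mathbb{K})$ of all $(d+1)\times(d+1)$ matrices over $\mathbb{K}$, $I$ its identity, and $V$ an irreducible left $\mathcal{A}$-module (so $\dim V=d+1$). For $X\in\mathcal{A}$, $\mathrm{tr}(X)$ is the trace of $X$ (equivalently of its action on $V$). Leonard system. An element of $\mathcal{A}$ is multiplicity-free if it has $d+1$ mutually distinct eigenvalues in $\mathbb{K}$. If $A$ is multiplicity-free with eigenvalues $\theta_0,\dots,\theta_d$, the primitive idempotent of $A$ associated with $\theta_i$ is $E_i=\prod_{0\le j\le d,\,j\ne i}\frac{A-\theta_jI}{\theta_i-\theta_j}$ (the projection onto the one-dimensional $\theta_i$-eigenspace $E_iV$). A Leonard system in $\mathcal{A}$ is a sequence $\Phi=(A;\{E_i\}_{i=0}^d;A^*;\{E^*_i\}_{i=0}^d)$ such that: (i) each of $A,A^*$ is a multiplicity-free element of $\mathcal{A}$ ($A^*$ is just another element; no adjoint is meant); (ii) $\{E_i\}_{i=0}^d$ is an ordering of the primitive idempotents of $A$; (iii) $\{E^*_i\}_{i=0}^d$ is an ordering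 of the primitive idempotents of $A^*$; (iv) for $0\le i,j\le d$, $E_iA^*E_j=0$ if $|i-j|>1$ and $E_iA^*E_j\ne0$ if $|i-j|=1$; (v) for $0\le i,j\le d$, $E^*_iAE^*_j=0$ if $|i-j|>1$ and $E^*_iAE^*_j\neq0$ if $|i-j|=1$. Parameter array. $\theta_i$ (resp. $\theta^*_i$) is the eigenvalue of $A$ (resp. $A^*$) associated with $E_i$ (resp. $E^*_i$). For $0\le i\le d$ define polynomials $\tau_i=(\lambda-\theta_0)(\lambda-\theta_1)\cdots(\lambda-\theta_{i-1})$, $\eta_i=(\lambda-\theta_d)(\lambda-\theta_{d-1})\cdots(\lambda-\theta_{d-i+1})$, $\tau^*_i=(\lambda-\theta^*_0)(\lambda-\theta^*_1)\cdots(\lambda-\theta^*_{i-1})$, $\eta^*_i=(\lambda-\theta^*_d)(\lambda-\theta^*_{d-1})\cdots(\lambda-\theta^*_{d-i+1})$. For $1\le i\le d$ define $\varphi_i=(\theta^*_0-\theta^*_i)\frac{\mathrm{tr}(\tau_i(A)E^*_0)}{\mathrm{tr}(\tau_{i-1}(A)E^*_0)}$ and $\phi_i=(\theta^*_0-\theta^*_i)\frac{\mathrm{tr}(\eta_i(A)E^*_0)}{\mathrm{tr}(\eta_{i-1}(A)E^*_0)}$; the denominators, and all $\varphi_i,\phi_i$, are known to be nonzero. The parameter array of $\Phi$ is $(\{\theta_i\}_{i=0}^d;\{\theta^*_i\}_{i=0}^d;\{\varphi_i\}_{i=1}^d;\{\phi_i\}_{i=1}^d)$. Abbreviate $\varphi=\varphi_1\varphi_2\cdots\varphi_d$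 and $\phi=\phi_1\phi_2\cdots\phi_d$. Empty products are $1$. Bilinear form. There is a unique antiautomorphism $\dagger$ of $\mathcal{A}$ ($\mathbb{K}$-linear bijection with $(XY)^\dagger=Y^\dagger X^\dagger$) with $A^\dagger=A$ and $A^{*\dagger}=A^*$. $\langle\,,\rangle$ denotes a fixed nonzero bilinear form on $V$ with $\langle Xu,v\rangle=\langle u,X^\dagger v\rangle$ for all $X\in\mathcal{A}$, $u,v\in V$; it exists, is unique up to a nonzero scalar factor, and is nondegenerate and symmetric. All scalars appearing in denominators (traces and inner products) are known to be nonzero. The notation $T\cdot v$ means the element $T\in\mathcal{A}$ (including the scalar prefactor and the whole sum) applied to $v\in V$. *)

theory Defs
  imports "HOL-Analysis.Determinants" "HOL-Computational_Algebra.Polynomial"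
begin

section \<open>A matrix algebra and an irreducible module\<close>

text \<open>The algebra is the whole type \<open>'a\<close>; \<open>rho\<close> is an isomorphism
  onto the full matrix algebra of order \<open>d + 1 = CARD('n)\<close>.\<close>

locale matrix_algebra = vector_space scaleA
  for scaleA :: "'k::field \<Rightarrow> 'a::ring_1 \<Rightarrow> 'a" +
  fixes d :: nat and rho :: "'a \<Rightarrow> 'k^'n^'n"
  assumes scale_mult_left: "scaleA c x * y = scaleA c (x * y)"
    and scale_mult_right: "x * scaleA c y = scaleA c (x * y)"
    and card_index: "CARD('n) = d + 1"
    and rho_bij: "bij rho"
    and rho_add: "rho (x + y) = rho x + rho y"
    and rho_scale: "rho (scaleA c x) = (\<chi> i j. c * rho x $ i $ j)"
    and rho_mult: "rho (x * y) = rho x ** rho y"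
    and rho_one: "rho 1 = mat 1"

text \<open>The trace does not depend on the choice of \<open>rho\<close> (Skolem--Noether).\<close>

definition alg_trace :: "('a \<Rightarrow> 'k::field^'n^'n) \<Rightarrow> 'a \<Rightarrow> 'k" where
  "alg_trace rho x = trace (rho x)"

locale irreducible_module =
  algebra: vector_space scaleA + space: vector_space scaleV
  for scaleA :: "'k::field \<Rightarrow> 'a::ring_1 \<Rightarrow> 'a"
    and scaleV :: "'k \<Rightarrow> 'v::ab_group_add \<Rightarrow> 'v" +
  fixes act :: "'a \<Rightarrow> 'v \<Rightarrow> 'v"
  assumes act_add_left: "act (x + y) v = act x v + act y v"
    and act_add_right: "act x (u + v) = act x u + act x v"
    and act_mult: "act (x * y) v = act x (act y v)"
    and act_one: "act 1 v = v"
    and act_scale_left: "act (scaleA c x) v = scaleV c (act x v)"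
    and act_scale_right: "act x (scaleV c v) = scaleV c (act x v)"
    and nonzero: "\<exists>v::'v. v \<noteq> 0"
    and irreducible: "\<And>W. space.subspace W \<Longrightarrow> (\<And>x w. w \<in> W \<Longrightarrow> act x w \<in> W)
      \<Longrightarrow> W = {0} \<or> W = UNIV"

text \<open>Value of a polynomial at an element of the (noncommutative) algebra.\<close>

definition aeval :: "('k::field \<Rightarrow> 'a::ring_1 \<Rightarrow> 'a) \<Rightarrow> 'k poly \<Rightarrow> 'a \<Rightarrow> 'a" where
  "aeval scaleA p x = (\<Sum>i\<le>degree p. scaleA (coeff p i) (x ^ i))"

section \<open>Leonard systems\<close>

definition eigenvalues ::
  "('k::field \<Rightarrow> 'v::ab_group_add \<Rightarrow> 'v) \<Rightarrow> ('a \<Rightarrow> 'v \<Rightarrow> 'v) \<Rightarrow> 'a \<Rightarrow> 'k set" where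
  "eigenvalues scaleV act x = {t. \<exists>v. v \<noteq> 0 \<and> act x v = scaleV t v}"

definition multiplicity_free ::
  "('k::field \<Rightarrow> 'v::ab_group_add \<Rightarrow> 'v) \<Rightarrow> ('a \<Rightarrow> 'v \<Rightarrow> 'v) \<Rightarrow> nat \<Rightarrow> 'a \<Rightarrow> bool" where
  "multiplicity_free scaleV act d x \<longleftrightarrow> card (eigenvalues scaleV act x) = d + 1"

text \<open>The product of the \<open>(x - s 1) / (t - s)\<close> over the eigenvalues \<open>s \<noteq> t\<close> of \<open>x\<close>.
  The factors commute; it is taken in the commutative polynomial ring and
  then evaluated at \<open>x\<close>.\<close>

definition prim_idempotent ::
  "('k::field \<Rightarrow> 'a::ring_1 \<Rightarrow> 'a) \<Rightarrow> ('k \<Rightarrow> 'v::ab_group_add \<Rightarrow> 'v) \<Rightarrow>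
    ('a \<Rightarrow> 'v \<Rightarrow> 'v) \<Rightarrow> 'a \<Rightarrow> 'k \<Rightarrow> 'a" where
  "prim_idempotent scaleA scaleV act x t =
    aeval scaleA (\<Prod>s\<in>eigenvalues scaleV act x - {t}. smult (1 / (t - s)) [:- s, 1:]) x"

text \<open>Sequences indexed by \<open>0, ..., d\<close> are functions on \<open>nat\<close>; their values beyond \<open>d\<close>
  are irrelevant.\<close>

definition leonard_system ::
  "('k::field \<Rightarrow> 'a::ring_1 \<Rightarrow> 'a) \<Rightarrow> ('k \<Rightarrow> 'v::ab_group_add \<Rightarrow> 'v) \<Rightarrow>
    ('a \<Rightarrow> 'v \<Rightarrow> 'v) \<Rightarrow> nat \<Rightarrow> 'a \<Rightarrow> (nat \<Rightarrow> 'a) \<Rightarrow> 'a \<Rightarrow> (nat \<Rightarrow> 'a) \<Rightarrow> bool" where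
  "leonard_system scaleA scaleV act d A E As Es \<longleftrightarrow>
    multiplicity_free scaleV act d A \<and> multiplicity_free scaleV act d As \<and>
    bij_betw E {0..d} (prim_idempotent scaleA scaleV act A ` eigenvalues scaleV act A) \<and>
    bij_betw Es {0..d} (prim_idempotent scaleA scaleV act As ` eigenvalues scaleV act As) \<and>
    (\<forall>i\<le>d. \<forall>j\<le>d.
      (\<bar>int i - int j\<bar> > 1 \<longrightarrow> E i * As * E j = 0) \<and>
      (\<bar>int i - int j\<bar> = 1 \<longrightarrow> E i * As * E j \<noteq> 0)) \<and>
    (\<forall>i\<le>d. \<forall>j\<le>d.
      (\<bar>int i - int j\<bar> > 1 \<longrightarrow> Es i * A * Es j = 0) \<and>
      (\<bar>int i - int j\<bar> = 1 \<longrightarrow> Es i * A * Es j \<noteq> 0))"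

text \<open>The starred polynomials are obtained by applying these to the dual eigenvalues.\<close>

definition tau :: "(nat \<Rightarrow> 'k::field) \<Rightarrow> nat \<Rightarrow> 'k poly" where
  "tau th i = (\<Prod>j<i. [:- th j, 1:])"

definition eta :: "nat \<Rightarrow> (nat \<Rightarrow> 'k::field) \<Rightarrow> nat \<Rightarrow> 'k poly" where
  "eta d th i = (\<Prod>j<i. [:- th (d - j), 1:])"

definition parameter_array ::
  "('k::field \<Rightarrow> 'a::ring_1 \<Rightarrow> 'a) \<Rightarrow> ('k \<Rightarrow> 'v::ab_group_add \<Rightarrow> 'v) \<Rightarrow>
    ('a \<Rightarrow> 'v \<Rightarrow> 'v) \<Rightarrow> nat \<Rightarrow> ('a \<Rightarrow> 'k^'n^'n) \<Rightarrow>
    'a \<Rightarrow> (nat \<Rightarrow> 'a) \<Rightarrow> 'a \<Rightarrow> (nat \<Rightarrow> 'a) \<Rightarrow>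
    (nat \<Rightarrow> 'k) \<Rightarrow> (nat \<Rightarrow> 'k) \<Rightarrow> (nat \<Rightarrow> 'k) \<Rightarrow> (nat \<Rightarrow> 'k) \<Rightarrow> bool" where
  "parameter_array scaleA scaleV act d rho A E As Es th ths vphi phi \<longleftrightarrow>
    (\<forall>i\<le>d. th i \<in> eigenvalues scaleV act A \<and>
            E i = prim_idempotent scaleA scaleV act A (th i)) \<and>
    (\<forall>i\<le>d. ths i \<in> eigenvalues scaleV act As \<and>
            Es i = prim_idempotent scaleA scaleV act As (ths i)) \<and>
    (\<forall>i\<in>{1..d}. vphi i = (ths 0 - ths i) *
        (alg_trace rho (aeval scaleA (tau th i) A * Es 0) /
         alg_trace rho (aeval scaleA (tau th (i - 1)) A * Es 0))) \<and>
    (\<forall>i\<in>{1..d}. phi i = (ths 0 - ths i) *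
        (alg_trace rho (aeval scaleA (eta d th i) A * Es 0) /
         alg_trace rho (aeval scaleA (eta d th (i - 1)) A * Es 0)))"

section \<open>The antiautomorphism and the bilinear form\<close>

definition antiautomorphism ::
  "('k::field \<Rightarrow> 'a::ring_1 \<Rightarrow> 'a) \<Rightarrow> ('a \<Rightarrow> 'a) \<Rightarrow> bool" where
  "antiautomorphism scaleA dag \<longleftrightarrow>
    Vector_Spaces.linear scaleA scaleA dag \<and> bij dag \<and> (\<forall>x y. dag (x * y) = dag y * dag x)"

definition bilinear_form ::
  "('k::field \<Rightarrow> 'v::ab_group_add \<Rightarrow> 'v) \<Rightarrow> ('v \<Rightarrow> 'v \<Rightarrow> 'k) \<Rightarrow> bool" where
  "bilinear_form scaleV form \<longleftrightarrow>
    (\<forall>v. Vector_Spaces.linear scaleV (*) (\<lambda>u. form u v)) \<and>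
    (\<forall>u. Vector_Spaces.linear scaleV (*) (\<lambda>v. form u v))"

end

theory Submission
  imports Defs
begin

text \<open>Write \<open>w\<^sub>i = \<eta>\<^sup>*\<^sub>i(A\<^sup>*) \<xi>\<^sub>d\<close>. The sequence \<open>X\<close> may be arbitrary, because the vectors \<open>w\<^sub>i\<close>
are dual to the operators that stand to the right of \<open>X\<^sub>r\<close> in the sums:
\<open>E\<^sub>0 \<tau>\<^sup>*\<^bsub>d-r\<^esub>(A\<^sup>*) w\<^sub>i\<close> and \<open>E\<^sup>*\<^sub>d \<eta>\<^sub>r(A) w\<^sub>i\<close> vanish for \<open>r \<noteq> i\<close>. Hence each sum collapses
to its term \<open>r = i\<close>, and only the scalar in that term has to be identified. The two identities
with \<open>X\<^bsub>d-r\<^esub>\<close> are the other two for the reversed sequence.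

The vanishing of \<open>E\<^sub>0 p(A\<^sup>*) \<xi>\<^sub>d\<close> with \<open>p = \<tau>\<^sup>*\<^bsub>d-r\<^esub> \<eta>\<^sup>*\<^sub>i\<close> has two sources. If \<open>r < i\<close>, then \<open>p\<close>
vanishes at all eigenvalues of \<open>A\<^sup>*\<close>. If \<open>r > i\<close>, then \<open>p\<close> has degree below \<open>d\<close>, and since \<open>A\<^sup>*\<close>
is tridiagonal with respect to the \<open>E\<^sub>j\<close>, fewer than \<open>d\<close> applications cannot move \<open>\<xi>\<^sub>d\<close> down
to \<open>E\<^sub>0 V\<close> (\<open>aeval_lowers\<close>). For \<open>r = i\<close> the polynomial is monic of degree \<open>d\<close>, and only its
leading term contributes, so the value does not depend on \<open>i\<close> (\<open>split_dual_pairing\<close>).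

For \<open>E\<^sup>*\<^sub>d \<eta>\<^sub>r(A) w\<^sub>i\<close> the same lemma, with the two operators exchanged and both orderings reversed,
concerns \<open>u\<^sub>j = \<tau>\<^sub>j(A) \<xi>\<^sup>*\<^sub>0\<close>. The vectors \<open>w\<^bsub>d-j\<^esub>\<close> and \<open>u\<^sub>j\<close> both lie in
\<open>(E\<^sup>*\<^sub>0 V + \<dots> + E\<^sup>*\<^sub>j V) \<inter> (E\<^sub>j V + \<dots> + E\<^sub>d V)\<close>, whose nonzero members have a nonzero \<open>E\<^sup>*\<^sub>0\<close>
component (\<open>split_intersection_zero\<close>). Comparing these components gives
\<open>(A\<^sup>* - \<theta>\<^sup>*\<^sub>j) u\<^sub>j = c u\<^bsub>j-1\<^esub>\<close> with \<open>c = vphi j\<close> (\<open>split_lowering\<close>), and therefore \<open>w\<^sub>i\<close> is \<open>vphi d * \<dots> * vphi (d - i + 1)\<close> times a fixed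
multiple of \<open>u\<^bsub>d-i\<^esub>\<close> (\<open>split_pairing\<close>).

The remaining scalars come from the bilinear form: \<open>E\<^sup>*\<^sub>i\<close> is self-adjoint of rank one, so
\<open>E\<^sup>*\<^sub>i y = \<langle>y, \<xi>\<rangle>/\<langle>\<xi>, \<xi>\<rangle> \<xi>\<close> for every nonzero \<open>\<xi>\<close> in its range (\<open>act_rank_one_projection\<close>). The
denominators \<open>\<langle>\<xi>\<^sub>d, \<xi>\<^sup>*\<^sub>0\<rangle>\<close>, \<open>\<langle>\<xi>\<^sub>d, \<xi>\<^sup>*\<^sub>d\<rangle>\<close> and \<open>tr(E\<^sub>d E\<^sup>*\<^sub>d)\<close> are nonzero because an eigenvector of one
operator has nonzero first and last components with respect to the other; the \<open>vphi k\<close> and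
\<open>phi k\<close> are nonzero because the \<open>E\<^sup>*\<^sub>0\<close> components just compared are (\<open>tau_A_bottom_nonzero\<close>).\<close>

section \<open>Polynomials acting on a module\<close>

context irreducible_module
begin

lemma act_zero_left [simp]: "act 0 v = 0"
  using act_add_left[of 0 0 v] by simp

lemma act_zero_right [simp]: "act x 0 = 0"
  using act_add_right[of x 0 0] by simp

lemma act_sum_left: "act (\<Sum>i\<in>I. f i) v = (\<Sum>i\<in>I. act (f i) v)"
  by (induction I rule: infinite_finite_induct) (auto simp: act_add_left)

lemma act_sum_right: "act x (\<Sum>i\<in>I. f i) = (\<Sum>i\<in>I. act x (f i))"
  by (induction I rule: infinite_finite_induct) (auto simp: act_add_right)

lemma act_diff_right: "act x (u - v) = act x u - act x v"
  using act_add_right[of x "u - v" v] by (simp add: algebra_simps)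

lemma act_power_eigenvector:
  assumes "act x v = scaleV t v"
  shows "act (x ^ n) v = scaleV (t ^ n) v"
  by (induction n) (auto simp: act_one act_mult act_scale_right assms mult.commute)

lemma act_aeval:
  assumes "degree p \<le> n"
  shows "act (aeval scaleA p x) v = (\<Sum>i\<le>n. scaleV (coeff p i) (act (x ^ i) v))"
proof -
  have "(\<Sum>i\<le>degree p. scaleV (coeff p i) (act (x ^ i) v)) =
        (\<Sum>i\<le>n. scaleV (coeff p i) (act (x ^ i) v))"
    using assms by (intro sum.mono_neutral_left) (auto simp: coeff_eq_0)
  then show ?thesis
    by (simp add: aeval_def act_sum_left act_scale_left)
qed

lemma act_aeval_eigenvector:
  assumes "act x v = scaleV t v"
  shows "act (aeval scaleA p x) v = scaleV (poly p t) v"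
  by (simp add: act_aeval[OF order_refl] act_power_eigenvector[OF assms] poly_altdef
      space.scale_sum_left)

text \<open>The form in which duality is used: if the operators \<open>Y r\<close> annihilate \<open>w\<close> except for \<open>r = i\<close>, the
sum over \<open>r\<close> picks out \<open>X i\<close>, whatever the \<open>X r\<close> are.\<close>

lemma act_selected_summand:
  fixes i d :: nat
  assumes "i \<le> d" and "\<And>r. r \<le> d \<Longrightarrow> act (Y r) w = (if r = i then y else 0)"
    and "scaleV c y = z"
  shows "act (scaleA c (\<Sum>r\<le>d. X r * Y r)) w = act (X i) z"
proof -
  have "(\<Sum>r\<le>d. act (X r) (act (Y r) w)) = (\<Sum>r\<le>d. if r = i then act (X i) y else 0)"
    by (intro sum.cong) (auto simp: assms(2))
  also have "\<dots> = act (X i) y" using assms(1) by simp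
  finally show ?thesis
    by (simp add: act_scale_left act_sum_left act_mult act_scale_right assms(3)[symmetric])
qed

end

section \<open>Resolutions of the identity by rank one eigenprojections\<close>

text \<open>What remains of a multiplicity-free element once it acts on the module: the projections \<open>P i\<close> onto
its eigenlines. The last assumption expresses that each range has dimension at most one. Working with
the action alone makes the hypotheses invariant under reversing the order.\<close>

locale eigen_resolution = irreducible_module scaleA scaleV act
  for scaleA :: "'k::field \<Rightarrow> 'a::ring_1 \<Rightarrow> 'a"
    and scaleV :: "'k \<Rightarrow> 'v::ab_group_add \<Rightarrow> 'v"
    and act :: "'a \<Rightarrow> 'v \<Rightarrow> 'v" +
  fixes d :: nat and X :: 'a and t :: "nat \<Rightarrow> 'k" and P :: "nat \<Rightarrow> 'a"
  assumes inj_t: "inj_on t {..d}"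
    and eigen: "i \<le> d \<Longrightarrow> act X (act (P i) v) = scaleV (t i) (act (P i) v)"
    and orth: "i \<le> d \<Longrightarrow> j \<le> d \<Longrightarrow> act (P i) (act (P j) v) = (if i = j then act (P i) v else 0)"
    and resolution: "(\<Sum>i\<le>d. act (P i) v) = v"
    and line: "i \<le> d \<Longrightarrow> act (P i) v \<noteq> 0 \<Longrightarrow> \<exists>c. act (P i) w = scaleV c (act (P i) v)"
begin

lemma range_P: "i \<le> d \<Longrightarrow> v \<in> range (act (P i)) \<longleftrightarrow> act (P i) v = v"
  by (metis orth rangeE rangeI)

lemma other_component: "i \<le> d \<Longrightarrow> j \<le> d \<Longrightarrow> i \<noteq> j \<Longrightarrow> act (P i) v = v \<Longrightarrow> act (P j) v = 0"
  by (metis orth)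

lemma eq_0_if_components: 
  assumes "\<And>i. i \<le> d \<Longrightarrow> act (P i) v = 0"
  shows "v = 0"
  using resolution[of v] assms by simp

lemma on_line: "i \<le> d \<Longrightarrow> act (P i) v = v \<Longrightarrow> v \<noteq> 0 \<Longrightarrow> \<exists>c. act (P i) w = scaleV c v"
  using line[of i v w] by simp

lemma aeval_resolution:
  "act (aeval scaleA p X) v = (\<Sum>i\<le>d. scaleV (poly p (t i)) (act (P i) v))"
proof -
  have "act (aeval scaleA p X) v = act (aeval scaleA p X) (\<Sum>i\<le>d. act (P i) v)"
    by (simp add: resolution)
  also have "\<dots> = (\<Sum>i\<le>d. scaleV (poly p (t i)) (act (P i) v))"
    unfolding act_sum_right by (intro sum.cong refl act_aeval_eigenvector eigen) auto
  finally show ?thesis .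
qed

lemma component_aeval:
  assumes "j \<le> d"
  shows "act (P j) (act (aeval scaleA p X) v) = scaleV (poly p (t j)) (act (P j) v)"
proof -
  have "act (P j) (act (aeval scaleA p X) v) =
        (\<Sum>i\<le>d. if i = j then scaleV (poly p (t j)) (act (P j) v) else 0)"
    unfolding aeval_resolution act_sum_right
    by (intro sum.cong) (auto simp: act_scale_right orth assms)
  then show ?thesis using assms by simp
qed

lemma act_aeval_mult:
  "act (aeval scaleA (p * q) X) v = act (aeval scaleA p X) (act (aeval scaleA q X) v)"
  by (simp add: aeval_resolution[of "p * q"] aeval_resolution[of p] component_aeval)

lemma aeval_annihilates:
  assumes "\<And>i. i \<le> d \<Longrightarrow> poly p (t i) = 0 \<or> act (P i) v = 0"
  shows "act (aeval scaleA p X) v = 0"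
  unfolding aeval_resolution using assms by (intro sum.neutral) auto

lemma aeval_linear_factor:
  "act (aeval scaleA [:- c, 1:] X) v = act X v - scaleV c v"
  by (simp add: act_aeval[of _ 1] act_one)

lemma reverse: "eigen_resolution scaleA scaleV act d X (\<lambda>i. t (d - i)) (\<lambda>i. P (d - i))"
proof
  show "inj_on (\<lambda>i. t (d - i)) {..d}"
  proof (rule inj_onI)
    fix i j assume "i \<in> {..d}" "j \<in> {..d}" "t (d - i) = t (d - j)"
    then have "d - i = d - j" by (intro inj_onD[OF inj_t]) auto
    then show "i = j" using \<open>i \<in> {..d}\<close> \<open>j \<in> {..d}\<close> by auto
  qed
  show "(\<Sum>i\<le>d. act (P (d - i)) v) = v" for v
    by (subst (2) resolution[of v, symmetric])
      (rule sum.reindex_bij_witness[of _ "\<lambda>i. d - i" "\<lambda>i. d - i"]; simp)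
  fix i j v w assume i: "i \<le> d"
  show "act X (act (P (d - i)) v) = scaleV (t (d - i)) (act (P (d - i)) v)"
    by (rule eigen) simp
  show "act (P (d - i)) v \<noteq> 0 \<Longrightarrow> \<exists>c. act (P (d - i)) w = scaleV c (act (P (d - i)) v)"
    by (rule line) simp
  assume "j \<le> d"
  with i have "d - i = d - j \<longleftrightarrow> i = j" by arith
  then show "act (P (d - i)) (act (P (d - j)) v) = (if i = j then act (P (d - i)) v else 0)"
    using orth[of "d - i" "d - j" v] by simp
qed

end

section \<open>Tridiagonal action on a flag\<close>

text \<open>A Leonard system is a pair of such actions. Stating the theory for one of them makes it applicable to
either operator, and to either order of either sequence of projections.\<close>

locale tridiagonal = R: eigen_resolution scaleA scaleV act d A th E +
    D: eigen_resolution scaleA scaleV act d As ths Es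
  for scaleA :: "'k::field \<Rightarrow> 'a::ring_1 \<Rightarrow> 'a"
    and scaleV :: "'k \<Rightarrow> 'v::ab_group_add \<Rightarrow> 'v"
    and act :: "'a \<Rightarrow> 'v \<Rightarrow> 'v" and d A th E As ths Es +
  assumes far: "i \<le> d \<Longrightarrow> j \<le> d \<Longrightarrow> Suc i < j \<or> Suc j < i \<Longrightarrow> act (E i) (act As (act (E j) v)) = 0"
    and adjacent: "i \<le> d \<Longrightarrow> j \<le> d \<Longrightarrow> j = Suc i \<or> i = Suc j \<Longrightarrow>
      \<exists>v. act (E i) (act As (act (E j) v)) \<noteq> 0"
begin

text \<open>An operator that is nonzero on a line is injective on it.\<close>

lemma adjacent_nonzero:
  assumes "i \<le> d" "j \<le> d" "j = Suc i \<or> i = Suc j" "act (E j) x \<noteq> 0"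
  shows "act (E i) (act As (act (E j) x)) \<noteq> 0"
proof
  assume *: "act (E i) (act As (act (E j) x)) = 0"
  obtain v where v: "act (E i) (act As (act (E j) v)) \<noteq> 0" using adjacent assms by blast
  obtain c where "act (E j) v = scaleV c (act (E j) x)" using R.line assms by blast
  with v * show False by (simp add: R.act_scale_right)
qed

lemma reverse_resolution: "tridiagonal scaleA scaleV act d A (\<lambda>i. th (d - i)) (\<lambda>i. E (d - i)) As ths Es"
proof -
  interpret R': eigen_resolution scaleA scaleV act d A "\<lambda>i. th (d - i)" "\<lambda>i. E (d - i)"
    by (rule R.reverse)
  show ?thesis
  proof
    fix i j v
    show "i \<le> d \<Longrightarrow> j \<le> d \<Longrightarrow> Suc i < j \<or> Suc j < i \<Longrightarrow>
        act (E (d - i)) (act As (act (E (d - j)) v)) = 0"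
      by (rule far) arith+
    show "i \<le> d \<Longrightarrow> j \<le> d \<Longrightarrow> j = Suc i \<or> i = Suc j \<Longrightarrow>
        \<exists>v. act (E (d - i)) (act As (act (E (d - j)) v)) \<noteq> 0"
      by (rule adjacent) arith+
  qed
qed

lemma reverse_dual: "tridiagonal scaleA scaleV act d A th E As (\<lambda>i. ths (d - i)) (\<lambda>i. Es (d - i))"
proof -
  interpret D': eigen_resolution scaleA scaleV act d As "\<lambda>i. ths (d - i)" "\<lambda>i. Es (d - i)"
    by (rule D.reverse)
  show ?thesis
    using tridiagonal_axioms D'.eigen_resolution_axioms by (simp only: tridiagonal_def)
qed

text \<open>Each application of \<open>As\<close> moves the lowest component of a vector down by one place, and the new
lowest component is nonzero because only the old one can contribute to it.\<close>

lemma power_lowers: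
  assumes "m \<le> d" and "\<And>i. i < m \<Longrightarrow> act (E i) x = 0"
  shows "i + k < m \<Longrightarrow> act (E i) (act (As ^ k) x) = 0"
    and "k \<le> m \<Longrightarrow> act (E m) x \<noteq> 0 \<Longrightarrow> act (E (m - k)) (act (As ^ k) x) \<noteq> 0"
proof -
  have "(\<forall>i. i + k < m \<longrightarrow> act (E i) (act (As ^ k) x) = 0) \<and>
     (k \<le> m \<longrightarrow> act (E m) x \<noteq> 0 \<longrightarrow> act (E (m - k)) (act (As ^ k) x) \<noteq> 0)"
  proof (induction k)
    case 0
    show ?case using assms(2) by (simp add: R.act_one)
  next
    case (Suc k)
    define y where "y = act (As ^ k) x"
    have y: "act (E j) y = 0" if "j + k < m" for j
      using Suc.IH that y_def by blast
    have ex: "act (E i) (act (As ^ Suc k) x) = (\<Sum>j\<le>d. act (E i) (act As (act (E j) y)))" for i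
      unfolding R.act_sum_right[symmetric] R.resolution by (simp add: R.act_mult y_def)
    have van: "act (E i) (act As (act (E j) y)) = 0"
      if "i + k < m" "j \<le> d" "j + k \<noteq> m \<or> i + Suc k < m" for i j
    proof (cases "j + k < m")
      case True then show ?thesis by (simp add: y)
    next
      case False
      then have "Suc i < j" using that(1,3) by arith
      then show ?thesis using that(2) by (intro far) auto
    qed
    have "act (E i) (act (As ^ Suc k) x) = 0" if "i + Suc k < m" for i
      unfolding ex using that by (intro sum.neutral) (auto intro!: van)
    moreover have "act (E (m - Suc k)) (act (As ^ Suc k) x) \<noteq> 0"
      if 2: "Suc k \<le> m" "act (E m) x \<noteq> 0"
    proof -
      let ?i = "m - Suc k" and ?j = "m - k"
      have "(\<Sum>j\<le>d. act (E ?i) (act As (act (E j) y))) =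
            (\<Sum>j\<in>{?j}. act (E ?i) (act As (act (E j) y)))"
        using 2 assms(1) by (intro sum.mono_neutral_right ballI van) auto
      moreover have "act (E ?i) (act As (act (E ?j) y)) \<noteq> 0"
      proof (rule adjacent_nonzero)
        show "act (E ?j) y \<noteq> 0" using 2 Suc.IH by (simp add: y_def)
      qed (use 2 assms(1) in arith)+
      ultimately show ?thesis unfolding ex by simp
    qed
    ultimately show ?case by blast
  qed
  then show "i + k < m \<Longrightarrow> act (E i) (act (As ^ k) x) = 0"
    and "k \<le> m \<Longrightarrow> act (E m) x \<noteq> 0 \<Longrightarrow> act (E (m - k)) (act (As ^ k) x) \<noteq> 0"
    by blast+
qed

text \<open>Consequently a polynomial of degree at most \<open>k\<close> reaches \<open>k\<close> places down through its leading term
only. Its other coefficients do not matter there, which allows \<open>\<tau>\<close> and \<open>\<eta>\<close> to be exchanged.\<close>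

lemma aeval_lowers:
  assumes "m \<le> d" and "\<And>i. i < m \<Longrightarrow> act (E i) x = 0" and "degree p \<le> k"
  shows "i + k < m \<Longrightarrow> act (E i) (act (aeval scaleA p As) x) = 0"
    and "k \<le> m \<Longrightarrow> act (E (m - k)) (act (aeval scaleA p As) x) =
           scaleV (coeff p k) (act (E (m - k)) (act (As ^ k) x))"
proof -
  have ex: "act (E i) (act (aeval scaleA p As) x) =
      (\<Sum>l\<le>k. scaleV (coeff p l) (act (E i) (act (As ^ l) x)))" for i
    by (simp add: R.act_aeval[OF assms(3)] R.act_sum_right R.act_scale_right)
  show "i + k < m \<Longrightarrow> act (E i) (act (aeval scaleA p As) x) = 0"
    unfolding ex by (intro sum.neutral) (auto intro!: power_lowers(1)[OF assms(1,2)])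
  assume "k \<le> m"
  then have "(\<Sum>l\<le>k. scaleV (coeff p l) (act (E (m - k)) (act (As ^ l) x))) =
     (\<Sum>l\<in>{k}. scaleV (coeff p l) (act (E (m - k)) (act (As ^ l) x)))"
    by (intro sum.mono_neutral_right) (auto simp: power_lowers(1)[OF assms(1,2)])
  then show "act (E (m - k)) (act (aeval scaleA p As) x) =
           scaleV (coeff p k) (act (E (m - k)) (act (As ^ k) x))"
    unfolding ex by simp
qed

text \<open>If \<open>x\<close> had lowest component in place \<open>i \<ge> m\<close>, then \<open>\<lambda>\<^bsup>i-m\<^esup> p\<close>, which is monic of degree \<open>i\<close> and
also annihilates \<open>x\<close>, would move it to a nonzero component in place \<open>0\<close>.\<close>

lemma flag_annihilator_zero:
  assumes "\<And>i. i < m \<Longrightarrow> i \<le> d \<Longrightarrow> act (E i) x = 0"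
    and "lead_coeff p = 1" "degree p = m" "act (aeval scaleA p As) x = 0"
  shows "x = 0"
proof (rule R.eq_0_if_components)
  fix i show "i \<le> d \<Longrightarrow> act (E i) x = 0"
  proof (induction i rule: less_induct)
    case (less i)
    show ?case
    proof (cases "i < m")
      case True then show ?thesis using assms less by blast
    next
      case False
      define q where "q = monom 1 (i - m) * p"
      have p0: "p \<noteq> 0" using assms(2) by auto
      have m1: "degree (monom (1::'k) (i - m)) = i - m" "monom (1::'k) (i - m) \<noteq> 0"
        by (simp_all add: degree_monom_eq monom_eq_0_iff)
      have deg: "degree q = i"
        using False assms(3) by (simp add: q_def degree_mult_eq[OF m1(2) p0] m1(1))
      have "lead_coeff q = 1"
        by (simp only: q_def lead_coeff_mult lead_coeff_monom assms(2) mult_1)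
      then have lead: "coeff q i = 1" by (simp only: deg)
      have "act (aeval scaleA q As) x = 0"
        by (simp add: q_def D.act_aeval_mult assms(4))
      then have "act (E (i - i)) (act (As ^ i) x) = 0"
        using aeval_lowers(2)[of i x q i] less deg lead by simp
      then show ?thesis using power_lowers(2)[of i x i] less by auto
    qed
  qed
qed

text \<open>This is the preceding lemma for a linear polynomial: an eigenvector without first component would
have to vanish.\<close>

lemma dual_eigenvector_first_component:
  assumes "act As v = scaleV c v" "v \<noteq> 0"
  shows "act (E 0) v \<noteq> 0"
proof
  assume "act (E 0) v = 0"
  then have "v = 0"
    using assms(1) by (intro flag_annihilator_zero[of 1 v "[:- c, 1:]"]) (auto simp: D.aeval_linear_factor)
  with assms(2) show False by simp
qed

end

section \<open>The polynomials tau and eta\<close>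

lemma tau_Suc: "tau t (Suc i) = tau t i * [:- t i, 1:]"
  by (simp add: tau_def)

lemma degree_lead_tau: "degree (tau t i) = i \<and> lead_coeff (tau t i) = 1"
proof (induction i)
  case 0 show ?case by (simp add: tau_def)
next
  case (Suc i)
  have nz: "tau t i \<noteq> 0" using Suc by auto
  have "degree (tau t (Suc i)) = Suc i"
    unfolding tau_Suc using Suc by (subst degree_mult_eq[OF nz]) auto
  moreover have "lead_coeff (tau t (Suc i)) = 1"
    by (simp only: tau_Suc lead_coeff_mult Suc.IH[THEN conjunct2]) simp
  ultimately show ?case by blast
qed

lemmas degree_tau = degree_lead_tau[THEN conjunct1]
lemmas lead_coeff_tau = degree_lead_tau[THEN conjunct2]

lemma coeff_tau: "coeff (tau t i) i = 1"
  using lead_coeff_tau[of t i] by (simp only: degree_tau)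

lemma poly_tau: "poly (tau t i) x = (\<Prod>j<i. x - t j)"
  by (simp add: tau_def poly_prod)

lemma poly_tau_root: "j < i \<Longrightarrow> poly (tau t i) (t j) = 0"
  by (auto simp: poly_tau)

text \<open>Reversing the order of the eigenvalues exchanges the two families of polynomials; hence facts about
\<open>eta\<close> follow from facts about \<open>tau\<close>.\<close>

lemma eta_eq_tau: "eta d t i = tau (\<lambda>j. t (d - j)) i"
  by (simp add: eta_def tau_def)

lemma eta_reverse: "i \<le> d \<Longrightarrow> eta d (\<lambda>j. t (d - j)) i = tau t i"
  by (simp add: eta_def tau_def)

lemma poly_eta_root: "j \<le> d \<Longrightarrow> d < i + j \<Longrightarrow> poly (eta d t i) (t j) = 0"
  using poly_tau_root[of "d - j" i "\<lambda>j. t (d - j)"] by (simp add: eta_eq_tau)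

text \<open>With \<open>s k\<close> the trace of \<open>\<eta>\<^sub>k(A) E\<^sup>*\<^sub>0\<close>, this evaluates the product of all \<open>phi k\<close>.\<close>

lemma prod_ratio_telescope:
  fixes s :: "nat \<Rightarrow> 'k::field"
  assumes "\<And>k. k < n \<Longrightarrow> s k \<noteq> 0" and "s 0 = 1"
  shows "(\<Prod>k=1..n. a k * (s k / s (k - 1))) = (\<Prod>k=1..n. a k) * s n"
  using assms(1)
proof (induction n)
  case 0 then show ?case using assms(2) by simp
next
  case (Suc n)
  have "s n \<noteq> 0" using Suc.prems by simp
  then show ?case using Suc by simp
qed

section \<open>Duality between the two split sequences\<close>

context tridiagonal
begin

text \<open>The operator on the left is a polynomial in \<open>As\<close> of degree \<open>d - r + i\<close>. Below degree \<open>d\<close> it is too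
short to reach the first component from the last one; above degree \<open>d\<close> its roots exhaust the
spectrum of \<open>As\<close>; in degree \<open>d\<close> it is monic, and so is \<open>eta d ths d\<close>.\<close>

lemma split_dual_pairing:
  assumes x: "act (E d) x = x" and ir: "i \<le> d" "r \<le> d"
  shows "act (E 0) (act (aeval scaleA (tau ths (d - r)) As) (act (aeval scaleA (eta d ths i) As) x)) =
    (if r = i then act (E 0) (act (aeval scaleA (eta d ths d) As) x) else 0)"
proof -
  define p where "p = tau ths (d - r) * eta d ths i"
  have below: "act (E j) x = 0" if "j < d" for j
    using R.other_component[of d j x] x that by simp
  have nz: "tau ths (d - r) \<noteq> 0" "eta d ths i \<noteq> 0"
    using lead_coeff_tau[of ths "d - r"] lead_coeff_tau[of "\<lambda>j. ths (d - j)" i]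
    by (auto simp: eta_eq_tau)
  have deg: "degree p = d - r + i"
    unfolding p_def by (simp add: degree_mult_eq[OF nz]) (simp add: eta_eq_tau degree_tau)
  have lead: "lead_coeff p = 1"
    by (simp only: p_def lead_coeff_mult eta_eq_tau lead_coeff_tau mult_1)
  have p: "act (E 0) (act (aeval scaleA p As) x) =
      (if r = i then act (E 0) (act (aeval scaleA (eta d ths d) As) x) else 0)"
  proof (cases r i rule: linorder_cases)
    case less
    have "poly p (ths j) = 0" if "j \<le> d" for j
      using less ir that poly_tau_root[of j "d - r" ths] poly_eta_root[of j d i ths]
      by (cases "j < d - r") (auto simp: p_def)
    then have "act (aeval scaleA p As) x = 0" by (intro D.aeval_annihilates) auto
    then show ?thesis using less by simp
  next
    case greater
    then have "0 + (d - r + i) < d" using ir by arith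
    then have "act (E 0) (act (aeval scaleA p As) x) = 0"
      using deg by (intro aeval_lowers(1)[of d x p "d - r + i"] below) auto
    then show ?thesis using greater by simp
  next
    case equal
    \<comment> \<open>The leading term decides, so any two monic polynomials of degree \<open>d\<close> agree here.\<close>
    have top: "act (E 0) (act (aeval scaleA q As) x) = act (E 0) (act (As ^ d) x)"
      if "degree q = d" "lead_coeff q = 1" for q
      using aeval_lowers(2)[of d x q d, OF _ below] that by simp
    have "degree p = d" using deg equal ir by simp
    then show ?thesis
      using top[of p] top[of "eta d ths d"] lead equal by (simp add: eta_eq_tau degree_tau coeff_tau)
  qed
  then show ?thesis by (simp add: p_def D.act_aeval_mult)
qed

end

section \<open>The split basis of a Leonard system\<close>

locale leonard = tridiagonal scaleA scaleV act d A th E As ths Es +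
    dual: tridiagonal scaleA scaleV act d As ths Es A th E
  for scaleA :: "'k::field \<Rightarrow> 'a::ring_1 \<Rightarrow> 'a"
    and scaleV :: "'k \<Rightarrow> 'v::ab_group_add \<Rightarrow> 'v"
    and act :: "'a \<Rightarrow> 'v \<Rightarrow> 'v" and d A th E As ths Es
begin

lemma reverse_leonard:
  "leonard scaleA scaleV act d A (\<lambda>i. th (d - i)) (\<lambda>i. E (d - i)) As ths Es"
  by (intro leonard.intro reverse_resolution dual.reverse_dual)

text \<open>The vector \<open>\<tau>\<^sub>j(A) x\<close>, with \<open>x\<close> in the range of \<open>E\<^sup>*\<^sub>0\<close>, lies in
\<open>(E\<^sub>j V + \<dots> + E\<^sub>d V) \<inter> (E\<^sup>*\<^sub>0 V + \<dots> + E\<^sup>*\<^sub>j V)\<close>: the factors of \<open>\<tau>\<^sub>j\<close> remove the first \<open>j\<close>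
eigenlines of \<open>A\<close>, and \<open>j\<close> applications of \<open>A\<close> raise the starred index by at most \<open>j\<close>. Its
component in the extreme place \<open>j\<close> is nonzero, so the vector is nonzero as well.\<close>

lemma tau_A_components:
  assumes x: "act (Es 0) x = x" and "i \<le> d" "j \<le> d"
  shows "i < j \<Longrightarrow> act (E i) (act (aeval scaleA (tau th j) A) x) = 0"
    and "j < i \<Longrightarrow> act (Es i) (act (aeval scaleA (tau th j) A) x) = 0"
    and "x \<noteq> 0 \<Longrightarrow> act (Es j) (act (aeval scaleA (tau th j) A) x) \<noteq> 0"
proof -
  show "i < j \<Longrightarrow> act (E i) (act (aeval scaleA (tau th j) A) x) = 0"
    using assms by (simp add: R.component_aeval poly_tau_root)
  interpret rv: tridiagonal scaleA scaleV act d As "\<lambda>i. ths (d - i)" "\<lambda>i. Es (d - i)" A th E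
    by (rule dual.reverse_resolution)
  have below: "act (Es (d - k)) x = 0" if "k < d" for k
    using D.other_component[of 0 "d - k" x] x that by simp
  show "j < i \<Longrightarrow> act (Es i) (act (aeval scaleA (tau th j) A) x) = 0"
    using rv.aeval_lowers(1)[of d x "tau th j" j "d - i", OF _ below] assms by (simp add: degree_tau)
  assume "x \<noteq> 0"
  moreover have "act (Es (d - (d - j))) (act (aeval scaleA (tau th j) A) x) =
      act (Es (d - (d - j))) (act (A ^ j) x)"
    using rv.aeval_lowers(2)[of d x "tau th j" j, OF _ below] assms
    by (simp add: degree_tau coeff_tau)
  moreover have "act (Es (d - (d - j))) (act (A ^ j) x) \<noteq> 0" if "x \<noteq> 0"
    using rv.power_lowers(2)[of d x j, OF _ below] assms that by simp
  ultimately show "act (Es j) (act (aeval scaleA (tau th j) A) x) \<noteq> 0"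
    using assms by simp
qed

text \<open>A vector of the intersection above is determined by its \<open>E\<^sup>*\<^sub>0\<close> component: without it, the vector
is annihilated by \<open>(\<lambda> - \<theta>\<^sup>*\<^sub>1) \<cdots> (\<lambda> - \<theta>\<^sup>*\<^sub>j)\<close>, whose degree \<open>j\<close> is small enough for
\<open>flag_annihilator_zero\<close>.\<close>

lemma split_intersection_zero:
  assumes "j \<le> d" and "\<And>i. i < j \<Longrightarrow> act (E i) y = 0"
    and "\<And>i. j < i \<Longrightarrow> i \<le> d \<Longrightarrow> act (Es i) y = 0" and "act (Es 0) y = 0"
  shows "y = 0"
proof (rule flag_annihilator_zero)
  show "act (aeval scaleA (tau (\<lambda>k. ths (Suc k)) j) As) y = 0"
  proof (rule D.aeval_annihilates)
    fix i assume "i \<le> d"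
    show "poly (tau (\<lambda>k. ths (Suc k)) j) (ths i) = 0 \<or> act (Es i) y = 0"
    proof (cases "i = 0 \<or> j < i")
      case True then show ?thesis using assms \<open>i \<le> d\<close> by auto
    next
      case False
      then have "i - 1 < j" and "Suc (i - 1) = i" by auto
      then show ?thesis using poly_tau_root[of "i - 1" j "\<lambda>k. ths (Suc k)"] by simp
    qed
  qed
qed (use assms in \<open>auto simp: degree_tau coeff_tau\<close>)

text \<open>Otherwise \<open>\<tau>\<^sub>j(A) x\<close> would vanish by the preceding lemma, although its component in place \<open>j\<close> does
not. In terms of traces, \<open>tr(\<tau>\<^sub>j(A) E\<^sup>*\<^sub>0) \<noteq> 0\<close>. For \<open>\<eta>\<^sub>j\<close> the same holds by reversing the order of the \<open>E\<^sub>i\<close>.\<close>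

lemma tau_A_bottom_nonzero:
  assumes x: "act (Es 0) x = x" "x \<noteq> 0" and "j \<le> d"
  shows "act (Es 0) (act (aeval scaleA (tau th j) A) x) \<noteq> 0"
proof
  assume bot: "act (Es 0) (act (aeval scaleA (tau th j) A) x) = 0"
  have "act (aeval scaleA (tau th j) A) x = 0"
  proof (rule split_intersection_zero[OF assms(3) _ _ bot])
    fix i
    show "i < j \<Longrightarrow> act (E i) (act (aeval scaleA (tau th j) A) x) = 0"
      using tau_A_components(1)[OF x(1), of i j] assms(3) by simp
    show "j < i \<Longrightarrow> i \<le> d \<Longrightarrow> act (Es i) (act (aeval scaleA (tau th j) A) x) = 0"
      using tau_A_components(2)[OF x(1), of i j] assms(3) by simp
  qed
  then show False using tau_A_components(3)[OF x(1) assms(3,3) x(2)] by simp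
qed

text \<open>Here \<open>a\<close> and \<open>b\<close> are the two traces in the definition of \<open>vphi j\<close>. The difference of the two sides
lies in the intersection for \<open>j - 1\<close>, and the factor \<open>(\<theta>\<^sup>*\<^sub>0 - \<theta>\<^sup>*\<^sub>j) a / b\<close> is chosen so that its
\<open>E\<^sup>*\<^sub>0\<close> component cancels.\<close>

lemma split_lowering:
  assumes x: "act (Es 0) x = x" "x \<noteq> 0" and j: "1 \<le> j" "j \<le> d"
    and a: "act (Es 0) (act (aeval scaleA (tau th j) A) x) = scaleV a x"
    and b: "act (Es 0) (act (aeval scaleA (tau th (j - 1)) A) x) = scaleV b x"
  defines "u \<equiv> \<lambda>j. act (aeval scaleA (tau th j) A) x"
  shows "act As (u j) - scaleV (ths j) (u j) = scaleV ((ths 0 - ths j) * (a / b)) (u (j - 1))"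
proof -
  define z where "z = act As (u j) - scaleV (ths j) (u j)"
  define c where "c = (ths 0 - ths j) * (a / b)"
  have b0: "b \<noteq> 0" using tau_A_bottom_nonzero[OF x, of "j - 1"] j b by auto
  have z: "z = act (aeval scaleA [:- ths j, 1:] As) (u j)"
    by (simp add: z_def D.aeval_linear_factor)
  have zs: "act (Es i) z = scaleV (ths i - ths j) (act (Es i) (u j))" if "i \<le> d" for i
    unfolding z by (simp add: D.component_aeval that)
  have uE: "act (E i) (u k) = 0" if "i < k" "k \<le> d" for i k
    unfolding u_def using tau_A_components(1)[OF x(1), of i k] that by simp
  have uEs: "act (Es i) (u k) = 0" if "k < i" "i \<le> d" for i k
    unfolding u_def using tau_A_components(2)[OF x(1), of i k] that by simp
  have "z - scaleV c (u (j - 1)) = 0"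
  proof (rule split_intersection_zero[of "j - 1"])
    show "j - 1 \<le> d" using j by simp
    fix i
    show "act (E i) (z - scaleV c (u (j - 1))) = 0" if "i < j - 1"
    proof -
      have "act (E i) z = 0" unfolding z
        by (rule aeval_lowers(1)[of j _ _ 1]) (use that j uE in auto)
      then show ?thesis using uE[of i "j - 1"] that j
        by (simp add: R.act_diff_right R.act_scale_right)
    qed
    show "act (Es i) (z - scaleV c (u (j - 1))) = 0" if "j - 1 < i" "i \<le> d"
    proof -
      have "act (Es i) z = 0" using zs[OF that(2)] uEs[of j i] that by (cases "i = j") auto
      then show ?thesis using uEs[of "j - 1" i] that
        by (simp add: R.act_diff_right R.act_scale_right)
    qed
  next
    have "act (Es 0) z = scaleV ((ths 0 - ths j) * a) x"
      using zs[of 0] a by (simp add: u_def)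
    moreover have "act (Es 0) (u (j - 1)) = scaleV b x" using b by (simp add: u_def)
    ultimately show "act (Es 0) (z - scaleV c (u (j - 1))) = 0"
      using b0 by (simp add: R.act_diff_right R.act_scale_right c_def)
  qed
  then show ?thesis by (simp add: z_def c_def)
qed

text \<open>The scalars \<open>s k\<close> stand for \<open>tr(\<tau>\<^sub>k(A) E\<^sup>*\<^sub>0)\<close>. Characterizing them by their action on \<open>x\<close> keeps
the trace out of the argument, and lets the same statements serve for \<open>\<eta>\<^sub>k\<close> and the second
half of the parameter array after reversal.\<close>

context
  fixes x :: 'v and s vphi :: "nat \<Rightarrow> 'k"
  assumes x: "act (Es 0) x = x" "x \<noteq> 0"
    and s: "\<And>k. k \<le> d \<Longrightarrow> act (Es 0) (act (aeval scaleA (tau th k) A) x) = scaleV (s k) x"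
    and vphi: "\<And>k. 1 \<le> k \<Longrightarrow> k \<le> d \<Longrightarrow> vphi k = (ths 0 - ths k) * (s k / s (k - 1))"
begin

lemma vphi_nonzero:
  assumes "1 \<le> k" "k \<le> d"
  shows "vphi k \<noteq> 0"
proof -
  have "s i \<noteq> 0" if "i \<le> d" for i
    using tau_A_bottom_nonzero[OF x that] s[OF that] by auto
  moreover have "ths 0 \<noteq> ths k"
    using inj_onD[OF D.inj_t, of 0 k] assms by auto
  ultimately show ?thesis using vphi assms by simp
qed

text \<open>The factors of \<open>\<eta>\<^sup>*\<^sub>i(A\<^sup>*)\<close> are applied in the order \<open>A\<^sup>* - \<theta>\<^sup>*\<^sub>d\<close>, \<open>A\<^sup>* - \<theta>\<^sup>*\<^bsub>d-1\<^esub>\<close>, \<dots>; each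
lowers the index by one and contributes one factor \<open>vphi k\<close>.\<close>

lemma eta_As_split_basis:
  assumes "i \<le> d"
  shows "act (aeval scaleA (eta d ths i) As) (act (aeval scaleA (tau th d) A) x) =
    scaleV (\<Prod>k=d-i+1..d. vphi k) (act (aeval scaleA (tau th (d - i)) A) x)"
  using assms
proof (induction i)
  case 0
  show ?case by (simp add: eta_eq_tau tau_def R.act_aeval[of _ 0] R.act_one)
next
  case (Suc i)
  let ?u = "\<lambda>j. act (aeval scaleA (tau th j) A) x"
  have "eta d ths (Suc i) = [:- ths (d - i), 1:] * eta d ths i"
    by (simp add: eta_eq_tau tau_Suc)
  then have "act (aeval scaleA (eta d ths (Suc i)) As) (?u d) =
      act (aeval scaleA [:- ths (d - i), 1:] As) (act (aeval scaleA (eta d ths i) As) (?u d))"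
    by (simp only: D.act_aeval_mult)
  also have "\<dots> = scaleV (\<Prod>k=d-i+1..d. vphi k)
      (act As (?u (d - i)) - scaleV (ths (d - i)) (?u (d - i)))"
    using Suc by (simp only: R.act_scale_right D.aeval_linear_factor)
  also have "act As (?u (d - i)) - scaleV (ths (d - i)) (?u (d - i)) =
      scaleV (vphi (d - i)) (?u (d - Suc i))"
    using split_lowering[OF x, of "d - i"] s[of "d - i"] s[of "d - i - 1"] vphi[of "d - i"] Suc.prems
    by simp
  also have "scaleV (\<Prod>k=d-i+1..d. vphi k) (scaleV (vphi (d - i)) (?u (d - Suc i))) =
      scaleV (vphi (d - i) * (\<Prod>k=d-i+1..d. vphi k)) (?u (d - Suc i))"
    by (simp add: mult.commute)
  also have "vphi (d - i) * (\<Prod>k=d-i+1..d. vphi k) = (\<Prod>k=d-Suc i+1..d. vphi k)"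
    using Suc.prems prod.atLeast_Suc_atMost[of "d - i" d vphi] by (simp add: Suc_diff_Suc)
  finally show ?case .
qed

text \<open>Since \<open>\<tau>\<^sub>d(A) x\<close> spans the range of \<open>E\<^sub>d\<close>, the vector \<open>y\<close> may be replaced by it. Then
\<open>\<eta>\<^sup>*\<^sub>i(A\<^sup>*) y\<close> becomes a multiple of \<open>\<tau>\<^bsub>d-i\<^esub>(A) x\<close>, and \<open>split_dual_pairing\<close> applies with
the two operators exchanged and both orders reversed.\<close>

lemma split_pairing:
  assumes y: "act (E d) y = y" and ir: "i \<le> d" "r \<le> d"
  shows "act (Es d) (act (aeval scaleA (eta d th r) A) (act (aeval scaleA (eta d ths i) As) y)) =
    (if r = i then scaleV (\<Prod>k=d-i+1..d. vphi k) (act (Es d) y) else 0)"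
proof -
  let ?u = "\<lambda>j. act (aeval scaleA (tau th j) A) x"
  have ud: "?u d \<noteq> 0" using tau_A_bottom_nonzero[OF x, of d] by auto
  have "(\<Sum>i\<le>d. act (E i) (?u d)) = (\<Sum>i\<in>{d}. act (E i) (?u d))"
    by (intro sum.mono_neutral_right) (auto simp: tau_A_components(1)[OF x(1)])
  then have Eud: "act (E d) (?u d) = ?u d" using R.resolution[of "?u d"] by simp
  obtain c where c: "y = scaleV c (?u d)"
    using R.on_line[OF _ Eud ud, of y] y by auto
  interpret rv: tridiagonal scaleA scaleV act d As "\<lambda>i. ths (d - i)" "\<lambda>i. Es (d - i)"
      A "\<lambda>i. th (d - i)" "\<lambda>i. E (d - i)"
    by (rule tridiagonal.reverse_dual[OF dual.reverse_resolution])
  have "act (Es d) (act (aeval scaleA (eta d th r) A) (?u (d - i))) =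
      (if r = i then act (Es d) (?u d) else 0)"
    using rv.split_dual_pairing[of x "d - i" "d - r"] x ir
    by (auto simp: eta_reverse simp flip: eta_eq_tau)
  then show ?thesis
    by (simp add: c R.act_scale_right eta_As_split_basis[OF ir(1)] mult.commute)
qed

end

text \<open>Applied to \<open>\<xi>\<^sub>d\<close>, this shows that \<open>\<langle>\<xi>\<^sub>d, \<xi>\<^sup>*\<^sub>0\<rangle>\<close> and \<open>\<langle>\<xi>\<^sub>d, \<xi>\<^sup>*\<^sub>d\<rangle>\<close> are nonzero.\<close>

lemma eigenvector_end_components_nonzero:
  assumes "act A v = scaleV c v" "v \<noteq> 0"
  shows "act (Es 0) v \<noteq> 0" "act (Es d) v \<noteq> 0"
  using dual.dual_eigenvector_first_component[OF assms]
    tridiagonal.dual_eigenvector_first_component[OF dual.reverse_resolution assms] by simp_all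

end

section \<open>From the matrix algebra to its irreducible module\<close>

text \<open>The matrix has entries \<open>z0 $ i * l j\<close> for some \<open>l\<close>, and both its trace and its eigenvalue on \<open>z0\<close>
are the sum of the \<open>l j * z0 $ j\<close>.\<close>

lemma trace_of_rank_one:
  fixes M :: "'k::field^'n^'n"
  assumes "\<And>z. \<exists>c. M *v z = c *s z0"
  shows "M *v z0 = trace M *s z0"
proof -
  obtain l where l: "\<And>z. M *v z = l z *s z0" using assms by metis
  have entry: "M $ i $ j = l (axis j 1) * z0 $ i" for i j
  proof -
    have "M $ i $ j = (M *v axis j 1) $ i"
      by (simp add: matrix_vector_mult_def axis_def if_distrib[of "\<lambda>c. _ * c"] cong: if_cong)
    then show ?thesis by (simp add: l)
  qed
  show ?thesis
    by (simp add: vec_eq_iff matrix_vector_mult_def trace_def entry sum_distrib_left sum_distrib_right mult_ac)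
qed

locale matrix_algebra_module =
  matrix_algebra scaleA d rho + irreducible_module scaleA scaleV act
  for scaleA :: "'k::field \<Rightarrow> 'a::ring_1 \<Rightarrow> 'a"
    and scaleV :: "'k \<Rightarrow> 'v::ab_group_add \<Rightarrow> 'v"
    and act :: "'a \<Rightarrow> 'v \<Rightarrow> 'v"
    and d :: nat and rho :: "'a \<Rightarrow> 'k^'n^'n"
begin

lemma rho_inv [simp]: "rho (inv rho M) = M"
  using rho_bij by (simp add: bij_is_surj surj_f_inv_f)

lemma rho_eqI: "rho x = rho y \<Longrightarrow> x = y"
  using rho_bij by (meson bij_is_inj injD)

lemma rho_zero: "rho 0 = 0"
  using rho_add[of 0 0] by simp

lemma rho_sum: "rho (\<Sum>i\<in>I. f i) = (\<Sum>i\<in>I. rho (f i))"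
  by (induction I rule: infinite_finite_induct) (auto simp: rho_add rho_zero)

text \<open>Up to isomorphism the module consists of the column vectors. With matrix units \<open>e a b\<close>, some
\<open>e b b\<close> does not annihilate the module, say \<open>e b b v \<noteq> 0\<close>; the vectors \<open>e a b v\<close> are then permuted
like the standard basis vectors. The map is injective because \<open>e b c\<close> recovers the
\<open>c\<close>th coordinate, and surjective because its range is a nonzero submodule.\<close>

lemma standard_module_isomorphism:
  obtains psi :: "'k^'n \<Rightarrow> 'v"
  where "\<And>y z. psi (y + z) = psi y + psi z" and "\<And>c z. psi (c *s z) = scaleV c (psi z)"
    and "\<And>x z. psi (rho x *v z) = act x (psi z)" and "bij psi"
proof -
  define e where "e a b = inv rho (\<chi> i j. if i = a \<and> j = b then 1 else 0)" for a b
  have rho_e: "rho (e a b) $ i $ j = (if i = a \<and> j = b then 1 else 0)" for a b i j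
    by (simp add: e_def)
  have e_mult: "e a b * e b' c = (if b = b' then e a c else 0)" for a b b' c
  proof (rule rho_eqI)
    have "(\<Sum>k\<in>UNIV. (if i = a \<and> k = b then 1 else 0) * (if k = b' \<and> j = c then 1 else 0)) =
        (\<Sum>k\<in>UNIV. if k = b then (if i = a \<and> b = b' \<and> j = c then 1 else (0::'k)) else 0)" for i j
      by (intro sum.cong) auto
    then show "rho (e a b * e b' c) = rho (if b = b' then e a c else 0)"
      by (auto simp: vec_eq_iff rho_mult matrix_matrix_mult_def rho_e rho_zero)
  qed
  have e_one: "(\<Sum>b\<in>UNIV. e b b) = 1"
  proof (rule rho_eqI)
    have "(\<Sum>b\<in>UNIV. if i = b \<and> j = b then 1 else 0) =
        (\<Sum>b\<in>UNIV. if b = i then (if i = j then 1 else (0::'k)) else 0)" for i j :: 'n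
      by (intro sum.cong) auto
    then show "rho (\<Sum>b\<in>UNIV. e b b) = rho 1"
      by (simp add: rho_sum rho_one vec_eq_iff rho_e mat_def)
  qed
  have mult_e: "x * e c b = (\<Sum>a\<in>UNIV. scaleA (rho x $ a $ c) (e a b))" for x c b
  proof (rule rho_eqI)
    have "(\<Sum>k\<in>UNIV. rho x $ i $ k * (if k = c \<and> j = b then 1 else 0)) =
        (\<Sum>k\<in>UNIV. if k = c then (if j = b then rho x $ i $ c else 0) else 0)" for i j
      by (intro sum.cong) auto
    moreover have "(\<Sum>a\<in>UNIV. rho x $ a $ c * (if i = a \<and> j = b then 1 else 0)) =
        (\<Sum>a\<in>UNIV. if a = i then (if j = b then rho x $ i $ c else 0) else 0)" for i j
      by (intro sum.cong) auto
    ultimately show "rho (x * e c b) = rho (\<Sum>a\<in>UNIV. scaleA (rho x $ a $ c) (e a b))"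
      by (simp add: rho_sum rho_scale rho_mult vec_eq_iff rho_e matrix_matrix_mult_def)
  qed
  obtain v :: 'v where v: "v \<noteq> 0" using nonzero by blast
  have "(\<Sum>b\<in>UNIV. act (e b b) v) = v"
    by (simp add: e_one act_one flip: act_sum_left)
  then have "(\<Sum>b\<in>UNIV. act (e b b) v) \<noteq> 0" using v by simp
  then obtain b where b: "act (e b b) v \<noteq> 0" by (rule sum.not_neutral_contains_not_neutral)
  define psi where "psi z = (\<Sum>a\<in>UNIV. scaleV (z $ a) (act (e a b) v))" for z :: "'k^'n"
  have add: "psi (y + z) = psi y + psi z" for y z
    by (simp add: psi_def space.scale_left_distrib sum.distrib)
  have scale: "psi (c *s z) = scaleV c (psi z)" for c z
    by (simp add: psi_def space.scale_sum_right)
  have hom: "psi (rho x *v z) = act x (psi z)" for x z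
  proof -
    have "act x (psi z) = (\<Sum>c\<in>UNIV. scaleV (z $ c) (act (x * e c b) v))"
      by (simp add: psi_def act_sum_right act_scale_right act_mult)
    also have "\<dots> = (\<Sum>c\<in>UNIV. \<Sum>a\<in>UNIV. scaleV (rho x $ a $ c * z $ c) (act (e a b) v))"
      by (simp add: mult_e act_sum_left act_scale_left space.scale_sum_right mult.commute)
    also have "\<dots> = (\<Sum>a\<in>UNIV. \<Sum>c\<in>UNIV. scaleV (rho x $ a $ c * z $ c) (act (e a b) v))"
      by (rule sum.swap)
    also have "\<dots> = psi (rho x *v z)"
      by (simp add: psi_def matrix_vector_mult_def space.scale_sum_left)
    finally show ?thesis by simp
  qed
  have coordinate: "act (e b c) (psi z) = scaleV (z $ c) (act (e b b) v)" for c z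
  proof -
    have "act (e b c) (psi z) = (\<Sum>a\<in>UNIV. scaleV (z $ a) (act (e b c * e a b) v))"
      by (simp add: psi_def act_sum_right act_scale_right act_mult)
    also have "\<dots> = (\<Sum>a\<in>UNIV. if a = c then scaleV (z $ c) (act (e b b) v) else 0)"
      by (intro sum.cong) (auto simp: e_mult)
    finally show ?thesis by simp
  qed
  have "inj psi"
  proof (rule injI)
    fix y z assume "psi y = psi z"
    then have "scaleV (y $ c) (act (e b b) v) = scaleV (z $ c) (act (e b b) v)" for c
      by (metis coordinate)
    then show "y = z" using b by (simp add: vec_eq_iff)
  qed
  moreover have "range psi = UNIV"
  proof -
    have zero: "psi 0 = 0" by (simp add: psi_def)
    have "space.subspace (range psi)"
    proof (rule space.subspaceI)
      show "0 \<in> range psi" using zero by (metis rangeI)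
      show "p + q \<in> range psi" if "p \<in> range psi" "q \<in> range psi" for p q
        using that by (auto simp flip: add)
      show "scaleV c p \<in> range psi" if "p \<in> range psi" for c p
        using that by (auto simp flip: scale)
    qed
    moreover have "act x w \<in> range psi" if "w \<in> range psi" for x w
      using that by (auto simp flip: hom)
    ultimately have "range psi = {0} \<or> range psi = UNIV" by (rule irreducible)
    moreover have "act (e b b) v \<in> range psi"
    proof -
      have "psi (axis b 1) = (\<Sum>a\<in>UNIV. if a = b then act (e b b) v else 0)"
        unfolding psi_def by (intro sum.cong) (auto simp: axis_def)
      then have "psi (axis b 1) = act (e b b) v" by simp
      then show ?thesis by (metis rangeI)
    qed
    ultimately show ?thesis using b by auto
  qed
  ultimately have "bij psi" by (simp add: bij_def)
  then show ?thesis using that[of psi] add scale hom by blast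
qed

lemma faithful:
  assumes "\<And>v. act x v = 0"
  shows "x = 0"
proof -
  obtain psi :: "'k^'n \<Rightarrow> 'v" where psi: "\<And>c z. psi (c *s z) = scaleV c (psi z)"
    "\<And>x z. psi (rho x *v z) = act x (psi z)" "bij psi"
    by (metis standard_module_isomorphism)
  have "psi 0 = 0" using psi(1)[of 0 0] by simp
  then have "rho x *v z = 0" for z
    using psi(2)[of x z] assms psi(3) by (metis bij_is_inj injD)
  then have "rho x = 0" by (simp add: matrix_eq)
  then show ?thesis using rho_zero by (metis rho_eqI)
qed

lemma finite_spanning_set:
  obtains T where "finite T" "card T \<le> d + 1" "space.span T = UNIV"
proof -
  obtain psi :: "'k^'n \<Rightarrow> 'v" where psi: "\<And>y z. psi (y + z) = psi y + psi z"
    "\<And>c z. psi (c *s z) = scaleV c (psi z)" "bij psi"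
    by (metis standard_module_isomorphism)
  let ?T = "range (\<lambda>a. psi (axis a 1))"
  have zero: "psi 0 = 0" using psi(2)[of 0 0] by simp
  have sum: "psi (\<Sum>a\<in>I. f a) = (\<Sum>a\<in>I. psi (f a))" for f and I :: "'n set"
    by (induction I rule: infinite_finite_induct) (auto simp: psi(1) zero)
  have "w \<in> space.span ?T" for w
  proof -
    obtain z where "w = psi z" using psi(3) by (metis bij_pointE)
    also have "z = (\<Sum>a\<in>UNIV. z $ a *s axis a 1)" by (rule basis_expansion[symmetric])
    also have "psi \<dots> = (\<Sum>a\<in>UNIV. scaleV (z $ a) (psi (axis a 1)))" by (simp add: sum psi(2))
    also have "\<dots> \<in> space.span ?T"
      by (intro space.span_sum space.span_scale space.span_base rangeI)
    finally show ?thesis .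
  qed
  moreover have "card ?T \<le> d + 1"
    using card_image_le[of UNIV "\<lambda>a. psi (axis a 1)"] card_index by simp
  ultimately show ?thesis using that[of ?T] by auto
qed

lemma act_trace:
  assumes "\<And>w. \<exists>c. act x w = scaleV c v"
  shows "act x v = scaleV (alg_trace rho x) v"
proof -
  obtain psi :: "'k^'n \<Rightarrow> 'v" where psi: "\<And>c z. psi (c *s z) = scaleV c (psi z)"
    "\<And>x z. psi (rho x *v z) = act x (psi z)" "bij psi"
    by (metis standard_module_isomorphism)
  obtain z0 where z0: "v = psi z0" using psi(3) by (metis bij_pointE)
  have "\<exists>c. rho x *v z = c *s z0" for z
    using assms[of "psi z"] psi by (metis z0 bij_is_inj injD)
  then have "rho x *v z0 = trace (rho x) *s z0" by (rule trace_of_rank_one)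
  then show ?thesis by (simp add: z0 alg_trace_def flip: psi(1,2))
qed

lemma alg_trace_commute: "alg_trace rho (x * y) = alg_trace rho (y * x)"
  unfolding alg_trace_def rho_mult by (rule trace_mul_sym)

text \<open>Each primitive idempotent is a Lagrange interpolation polynomial in \<open>X\<close>, so it fixes its own
eigenvector and annihilates those of the other eigenvalues. The \<open>d + 1\<close> eigenvectors are therefore
independent, and they span because the module is spanned by \<open>d + 1\<close> vectors.\<close>

lemma eigen_resolution_primitive_idempotents:
  assumes "multiplicity_free scaleV act d X" and inj: "inj_on t {..d}"
    and t: "\<And>i. i \<le> d \<Longrightarrow> t i \<in> eigenvalues scaleV act X"
    and P: "\<And>i. i \<le> d \<Longrightarrow> P i = prim_idempotent scaleA scaleV act X (t i)"
  shows "eigen_resolution scaleA scaleV act d X t P"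
proof -
  let ?S = "eigenvalues scaleV act X"
  have card: "card ?S = d + 1" using assms(1) by (simp add: multiplicity_free_def)
  then have fin: "finite ?S" using card.infinite by fastforce
  have S: "t ` {..d} = ?S"
    by (rule card_subset_eq[OF fin]) (use t card_image[OF inj] card in auto)
  have "\<forall>i\<in>{..d}. \<exists>v. v \<noteq> 0 \<and> act X v = scaleV (t i) v"
    using t by (auto simp: eigenvalues_def)
  then obtain v where v: "\<And>i. i \<le> d \<Longrightarrow> v i \<noteq> 0" "\<And>i. i \<le> d \<Longrightarrow> act X (v i) = scaleV (t i) (v i)"
    by (metis atMost_iff)
  have Pv: "act (P i) (v j) = (if i = j then v j else 0)" if "i \<le> d" "j \<le> d" for i j
  proof -
    let ?p = "\<Prod>s\<in>?S - {t i}. smult (1 / (t i - s)) [:- s, 1:]"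
    have eq: "act (P i) (v j) = scaleV (poly ?p (t j)) (v j)"
      unfolding P[OF that(1)] prim_idempotent_def by (rule act_aeval_eigenvector[OF v(2)[OF that(2)]])
    have "poly ?p (t j) = (\<Prod>s\<in>?S - {t i}. (t j - s) / (t i - s))"
      by (simp add: poly_prod diff_divide_distrib)
    also have "\<dots> = (if i = j then 1 else 0)"
    proof (cases "i = j")
      case True
      have "(\<Prod>s\<in>?S - {t i}. (t j - s) / (t i - s)) = 1"
        by (rule prod.neutral) (auto simp: True)
      then show ?thesis using True by simp
    next
      case False
      then have "t j \<in> ?S - {t i}" using t that inj_onD[OF inj, of i j] by auto
      then have "(\<Prod>s\<in>?S - {t i}. (t j - s) / (t i - s)) = 0"
        using fin by (intro prod_zero) auto
      then show ?thesis using False by simp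
    qed
    finally show ?thesis unfolding eq by simp
  qed
  have inj_v: "inj_on v {..d}"
    by (rule inj_onI) (metis Pv atMost_iff v(1))
  have act_comb: "act (P i) (\<Sum>j\<le>d. scaleV (c j) (v j)) = scaleV (c i) (v i)" if "i \<le> d" for i c
  proof -
    have "act (P i) (\<Sum>j\<le>d. scaleV (c j) (v j)) = (\<Sum>j\<le>d. if j = i then scaleV (c i) (v i) else 0)"
      unfolding act_sum_right act_scale_right by (intro sum.cong) (auto simp: Pv that)
    then show ?thesis using that by simp
  qed
  have combination: "(\<Sum>w\<in>v ` {..d}. scaleV (u w) w) = (\<Sum>j\<le>d. scaleV (u (v j)) (v j))" for u
    by (simp add: sum.reindex[OF inj_v])
  have ind: "space.independent (v ` {..d})"
  proof (subst space.independent_explicit_finite_subsets, intro allI impI ballI)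
    fix B u w assume B: "B \<subseteq> v ` {..d}" "finite B" "(\<Sum>w\<in>B. scaleV (u w) w) = 0" and w: "w \<in> B"
    define c where "c w = (if w \<in> B then u w else 0)" for w
    have "(\<Sum>w\<in>v ` {..d}. scaleV (c w) w) = (\<Sum>w\<in>B. scaleV (u w) w)"
      using B(1) by (intro sum.mono_neutral_cong_right) (auto simp: c_def)
    then have 0: "(\<Sum>j\<le>d. scaleV (c (v j)) (v j)) = 0" using B(3) combination[of c] by simp
    obtain i where i: "i \<le> d" "w = v i" using w B(1) by auto
    then have "scaleV (c (v i)) (v i) = 0" using act_comb[of i "\<lambda>j. c (v j)"] 0 by simp
    then show "u w = 0" using i v(1) w by (simp add: c_def)
  qed
  have span: "space.span (v ` {..d}) = UNIV"
  proof (rule ccontr)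
    assume "space.span (v ` {..d}) \<noteq> UNIV"
    then obtain w where w: "w \<notin> space.span (v ` {..d})" by blast
    then have "w \<notin> v ` {..d}" by (meson space.span_base)
    then have "card (insert w (v ` {..d})) = d + 2" by (simp add: card_image[OF inj_v])
    moreover have "space.independent (insert w (v ` {..d}))"
      by (rule space.independent_insertI[OF w ind])
    moreover obtain T where "finite T" "card T \<le> d + 1" "space.span T = UNIV"
      by (rule finite_spanning_set)
    ultimately show False
      using space.independent_span_bound[of T "insert w (v ` {..d})"] by simp
  qed
  have expand: "\<exists>c. w = (\<Sum>j\<le>d. scaleV (c j) (v j))" for w
  proof -
    have "w \<in> range (\<lambda>u. \<Sum>w\<in>v ` {..d}. scaleV (u w) w)"
      using span space.span_finite[of "v ` {..d}"] by auto
    then show ?thesis unfolding combination by auto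
  qed
  have on_line: "\<exists>c. act (P i) w = scaleV c (v i)" if "i \<le> d" for i w
    using expand[of w] act_comb[OF that] by blast
  show ?thesis
  proof
    show "inj_on t {..d}" by (rule inj)
    fix i j w z
    show "(\<Sum>i\<le>d. act (P i) w) = w"
    proof -
      obtain c where "w = (\<Sum>j\<le>d. scaleV (c j) (v j))" using expand by blast
      then show ?thesis by (simp add: act_comb)
    qed
    assume i: "i \<le> d"
    obtain c where c: "act (P i) w = scaleV c (v i)" using on_line i by blast
    show "act X (act (P i) w) = scaleV (t i) (act (P i) w)"
      by (simp add: c act_scale_right v i mult.commute)
    show "\<exists>c. act (P i) z = scaleV c (act (P i) w)" if "act (P i) w \<noteq> 0"
    proof -
      obtain c' where "act (P i) z = scaleV c' (v i)" using on_line i by blast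
      then have "act (P i) z = scaleV (c' / c) (act (P i) w)" using that c by auto
      then show ?thesis by blast
    qed
    assume j: "j \<le> d"
    obtain c' where "act (P j) w = scaleV c' (v j)" using on_line j by blast
    then show "act (P i) (act (P j) w) = (if i = j then act (P i) w else 0)"
      by (simp add: act_scale_right Pv i j)
  qed
qed

text \<open>The conditions on products in the algebra carry over to the action because the module is faithful.\<close>

lemma tridiagonal_from_products:
  assumes "eigen_resolution scaleA scaleV act d A th E" "eigen_resolution scaleA scaleV act d As ths Es"
    and far: "\<And>i j. i \<le> d \<Longrightarrow> j \<le> d \<Longrightarrow> \<bar>int i - int j\<bar> > 1 \<Longrightarrow> E i * As * E j = 0"
    and adj: "\<And>i j. i \<le> d \<Longrightarrow> j \<le> d \<Longrightarrow> \<bar>int i - int j\<bar> = 1 \<Longrightarrow> E i * As * E j \<noteq> 0"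
  shows "tridiagonal scaleA scaleV act d A th E As ths Es"
proof -
  have act: "act (E i) (act As (act (E j) v)) = act (E i * As * E j) v" for i j v
    by (simp add: act_mult)
  show ?thesis
  proof (intro tridiagonal.intro assms(1,2) tridiagonal_axioms.intro)
    fix i j v assume ij: "i \<le> d" "j \<le> d"
    show "act (E i) (act As (act (E j) v)) = 0" if "Suc i < j \<or> Suc j < i"
    proof -
      have "1 < \<bar>int i - int j\<bar>" using that by arith
      then show ?thesis unfolding act using far[OF ij] by simp
    qed
    show "\<exists>v. act (E i) (act As (act (E j) v)) \<noteq> 0" if "j = Suc i \<or> i = Suc j"
    proof (rule ccontr)
      assume "\<nexists>v. act (E i) (act As (act (E j) v)) \<noteq> 0"
      then have "E i * As * E j = 0" unfolding act by (intro faithful) auto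
      then show False using adj[OF ij] that by auto
    qed
  qed
qed

lemma leonard_from_leonard_system:
  assumes "leonard_system scaleA scaleV act d A E As Es"
    and "parameter_array scaleA scaleV act d rho A E As Es th ths vphi phi"
  shows "leonard scaleA scaleV act d A th E As ths Es"
proof -
  have bij: "bij_betw E {0..d} (prim_idempotent scaleA scaleV act A ` eigenvalues scaleV act A)"
    "bij_betw Es {0..d} (prim_idempotent scaleA scaleV act As ` eigenvalues scaleV act As)"
    using assms(1) by (auto simp: leonard_system_def)
  have par: "\<forall>i\<le>d. th i \<in> eigenvalues scaleV act A \<and> E i = prim_idempotent scaleA scaleV act A (th i)"
    "\<forall>i\<le>d. ths i \<in> eigenvalues scaleV act As \<and> Es i = prim_idempotent scaleA scaleV act As (ths i)"
    using assms(2) by (simp_all add: parameter_array_def)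
  have inj: "inj_on th {..d}" "inj_on ths {..d}"
    using bij par by (auto simp: bij_betw_def inj_on_def)
  have R: "eigen_resolution scaleA scaleV act d A th E"
    and D: "eigen_resolution scaleA scaleV act d As ths Es"
    using assms(1) par inj
    by (auto simp: leonard_system_def intro!: eigen_resolution_primitive_idempotents)
  show ?thesis
    using assms(1)
    by (intro leonard.intro tridiagonal_from_products R D) (auto simp: leonard_system_def)
qed

end

section \<open>The invariant bilinear form\<close>

locale invariant_form = irreducible_module scaleA scaleV act
  for scaleA :: "'k::field \<Rightarrow> 'a::ring_1 \<Rightarrow> 'a"
    and scaleV :: "'k \<Rightarrow> 'v::ab_group_add \<Rightarrow> 'v"
    and act :: "'a \<Rightarrow> 'v \<Rightarrow> 'v" +
  fixes dag :: "'a \<Rightarrow> 'a" and form :: "'v \<Rightarrow> 'v \<Rightarrow> 'k"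
  assumes anti: "antiautomorphism scaleA dag"
    and bilinear: "bilinear_form scaleV form"
    and form_nonzero: "\<exists>u v. form u v \<noteq> 0"
    and adjoint: "form (act x u) v = form u (act (dag x) v)"
begin

lemma dag_linear: "Vector_Spaces.linear scaleA scaleA dag"
  and dag_bij: "bij dag"
  and dag_mult: "dag (x * y) = dag y * dag x"
  using anti by (auto simp: antiautomorphism_def)

lemma form_left: "Vector_Spaces.linear scaleV (*) (\<lambda>u. form u v)"
  and form_right: "Vector_Spaces.linear scaleV (*) (\<lambda>v. form u v)"
  using bilinear by (auto simp: bilinear_form_def)

lemma form_add_left: "form (u + u') v = form u v + form u' v"
  using form_left[of v] by (simp add: Vector_Spaces.linear_iff)

lemma form_scale_left: "form (scaleV c u) v = c * form u v"
  using form_left[of v] by (simp add: Vector_Spaces.linear_iff)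

lemma form_scale_right: "form u (scaleV c v) = c * form u v"
  using form_right[of u] by (simp add: Vector_Spaces.linear_iff)

lemma form_zero_left: "form 0 v = 0"
  using form_scale_left[of 0 0 v] by simp

text \<open>An antiautomorphism is not assumed to fix the identity, but it does so: if \<open>dag y = 1\<close>, then
\<open>dag y = dag (y * 1) = dag 1 * dag y\<close>.\<close>

lemma dag_one: "dag 1 = 1"
proof -
  obtain y where "dag y = 1" using dag_bij by (metis bij_pointE)
  then show ?thesis using dag_mult[of y 1] by simp
qed

lemma dag_power: "dag x = x \<Longrightarrow> dag (x ^ n) = x ^ n"
  by (induction n) (simp_all add: dag_one dag_mult power_commutes)

lemma dag_aeval:
  assumes "dag x = x"
  shows "dag (aeval scaleA p x) = aeval scaleA p x"
proof -
  have add: "dag (y + z) = dag y + dag z" and scale: "dag (scaleA c y) = scaleA c (dag y)" for c y z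
    using dag_linear by (simp_all add: Vector_Spaces.linear_iff)
  have sum: "dag (\<Sum>i\<in>I. f i) = (\<Sum>i\<in>I. dag (f i))" for f and I :: "nat set"
    using add[of 0 0] by (induction I rule: infinite_finite_induct) (auto simp: add)
  show ?thesis by (simp add: aeval_def sum scale dag_power assms)
qed

lemma dag_prim_idempotent:
  "dag x = x \<Longrightarrow> dag (prim_idempotent scaleA scaleV act x t) = prim_idempotent scaleA scaleV act x t"
  unfolding prim_idempotent_def by (rule dag_aeval)

text \<open>The left radical of the form is a submodule, so by irreducibility it is zero unless the form
vanishes.\<close>

lemma form_nondegenerate:
  assumes "\<And>v. form u v = 0"
  shows "u = 0"
proof -
  let ?W = "{u. \<forall>v. form u v = 0}"
  have "space.subspace ?W"
    by (rule space.subspaceI) (auto simp: form_zero_left form_add_left form_scale_left)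
  moreover have "act x w \<in> ?W" if "w \<in> ?W" for x w
    using that by (simp add: adjoint)
  ultimately have "?W = {0} \<or> ?W = UNIV" by (rule irreducible)
  moreover have "?W \<noteq> UNIV" using form_nonzero by auto
  ultimately show ?thesis using assms by blast
qed

text \<open>A self-adjoint projection \<open>p\<close> onto the line spanned by \<open>x\<close>; it is applied to the \<open>E\<^sup>*\<^sub>i\<close>.\<close>

context
  fixes p :: 'a and x :: 'v
  assumes p: "dag p = p" "act p x = x" "x \<noteq> 0" "\<And>w. \<exists>c. act p w = scaleV c x"
begin

text \<open>Self-adjointness gives \<open>\<langle>x, w\<rangle> = \<langle>x, p w\<rangle>\<close>, a multiple of \<open>\<langle>x, x\<rangle>\<close>; so \<open>\<langle>x, x\<rangle> = 0\<close> would put \<open>x\<close>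
into the radical.\<close>

lemma form_self_nonzero: "form x x \<noteq> 0"
proof
  assume 0: "form x x = 0"
  have "form x w = 0" for w
  proof -
    obtain c where "act p w = scaleV c x" using p(4) by blast
    then have "form (act p x) w = 0" by (simp add: adjoint p(1) form_scale_right 0)
    then show ?thesis by (simp add: p(2))
  qed
  then show False using form_nondegenerate p(3) by blast
qed

lemma act_rank_one_projection: "act p y = scaleV (form y x / form x x) x"
proof -
  obtain c where c: "act p y = scaleV c x" using p(4) by blast
  have "form (act p y) x = form y x" by (simp add: adjoint p)
  then have "c = form y x / form x x"
    using form_self_nonzero by (simp add: c form_scale_left eq_divide_eq)
  then show ?thesis by (simp add: c)
qed

end

end

section \<open>Evaluation of the scalars\<close>

context eigen_resolution
begin

text \<open>All eigenvalues except \<open>t 0\<close> are roots of \<open>eta d t d\<close>.\<close>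

lemma aeval_eta_top:
  "act (aeval scaleA (eta d t d) X) v = scaleV (poly (eta d t d) (t 0)) (act (P 0) v)"
proof -
  have "act (aeval scaleA (eta d t d) X) v =
      (\<Sum>i\<in>{0}. scaleV (poly (eta d t d) (t i)) (act (P i) v))"
    unfolding aeval_resolution
    by (intro sum.mono_neutral_right) (auto simp: poly_eta_root)
  then show ?thesis by simp
qed

lemma poly_eta_top: "poly (eta d t d) (t 0) = (\<Prod>k=1..d. t 0 - t k)"
  unfolding eta_eq_tau poly_tau
  by (rule prod.reindex_bij_witness[of _ "\<lambda>k. d - k" "\<lambda>k. d - k"]) auto

end

context matrix_algebra_module
begin

text \<open>For \<open>p = E\<^sup>*\<^sub>0\<close> this reads the traces of the parameter array as scalars in the split basis.\<close>

lemma trace_on_line: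
  assumes "act p v = v" and "\<And>w. \<exists>c. act p w = scaleV c v"
  shows "act p (act x v) = scaleV (alg_trace rho (x * p)) v"
proof -
  have "\<exists>c. act (p * x) w = scaleV c v" for w
    using assms(2) by (simp add: act_mult)
  then have "act (p * x) v = scaleV (alg_trace rho (p * x)) v" by (rule act_trace)
  then show ?thesis by (simp add: act_mult alg_trace_commute[of x p])
qed

end

theorem theorem21p1:
  fixes scaleA :: "'k::field \<Rightarrow> 'a::ring_1 \<Rightarrow> 'a"
    and scaleV :: "'k \<Rightarrow> 'v::ab_group_add \<Rightarrow> 'v"
    and act :: "'a \<Rightarrow> 'v \<Rightarrow> 'v"
    and d :: nat
    and rho :: "'a \<Rightarrow> 'k^'n^'n"
    and A As :: 'a
    and E Es :: "nat \<Rightarrow> 'a"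
    and th ths vphi phi :: "nat \<Rightarrow> 'k"
    and dag :: "'a \<Rightarrow> 'a"
    and form :: "'v \<Rightarrow> 'v \<Rightarrow> 'k"
    and xi0 xid xis0 xisd :: 'v
  assumes "matrix_algebra scaleA d rho"
    and "irreducible_module scaleA scaleV act"
    and "leonard_system scaleA scaleV act d A E As Es"
    and "parameter_array scaleA scaleV act d rho A E As Es th ths vphi phi"
    and "antiautomorphism scaleA dag" and "dag A = A" and "dag As = As"
    and "bilinear_form scaleV form" and "\<exists>u v. form u v \<noteq> 0"
    and "\<And>x u v. form (act x u) v = form u (act (dag x) v)"
    and "xi0 \<in> range (act (E 0))" and "xi0 \<noteq> 0"
    and "xid \<in> range (act (E d))" and "xid \<noteq> 0"
    and "xis0 \<in> range (act (Es 0))" and "xis0 \<noteq> 0"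
    and "xisd \<in> range (act (Es d))" and "xisd \<noteq> 0"
  shows "(\<forall>X \<in> {E,
      \<lambda>i. E (d - i),
      \<lambda>i. aeval scaleA (tau th i) A,
      \<lambda>i. aeval scaleA (tau th (d - i)) A,
      \<lambda>i. aeval scaleA (eta d th i) A,
      \<lambda>i. aeval scaleA (eta d th (d - i)) A}. \<forall>i\<le>d.
       act (scaleA (poly (eta d th d) (th 0) / (\<Prod>k=1..d. phi k) * (form xis0 xis0 / form xid xis0))
           (\<Sum>r\<le>d. X r * Es 0 * E 0 * aeval scaleA (tau ths (d - r)) As))
         (act (aeval scaleA (eta d ths i) As) xid) = act (X i) xis0 \<and>
       act (scaleA (form xisd xisd / form xid xisd)
           (\<Sum>r\<le>d. scaleA (1 / (\<Prod>k=d-r+1..d. vphi k))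
               (X r * Es d * aeval scaleA (eta d th r) A)))
         (act (aeval scaleA (eta d ths i) As) xid) = act (X i) xisd \<and>
       act (scaleA (poly (eta d th d) (th 0) / (\<Prod>k=1..d. phi k) * (form xis0 xis0 / form xid xis0))
           (\<Sum>r\<le>d. X (d - r) * Es 0 * E 0 * aeval scaleA (tau ths (d - r)) As))
         (act (aeval scaleA (eta d ths (d - i)) As) xid) = act (X i) xis0 \<and>
       act (scaleA (form xisd xisd / form xid xisd)
           (\<Sum>r\<le>d. scaleA (1 / (\<Prod>k=d-r+1..d. vphi k))
               (X (d - r) * Es d * aeval scaleA (eta d th r) A)))
         (act (aeval scaleA (eta d ths (d - i)) As) xid) = act (X i) xisd) \<and>
    (\<forall>X \<in> {Es,
      \<lambda>i. Es (d - i),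
      \<lambda>i. aeval scaleA (tau ths i) As,
      \<lambda>i. aeval scaleA (tau ths (d - i)) As,
      \<lambda>i. aeval scaleA (eta d ths i) As,
      \<lambda>i. aeval scaleA (eta d ths (d - i)) As}. \<forall>i\<le>d.
       act (scaleA (poly (eta d th d) (th 0) / (\<Prod>k=1..d. vphi k) * (form xi0 xisd / form xid xisd))
           (\<Sum>r\<le>d. X r * E 0 * aeval scaleA (tau ths (d - r)) As))
         (act (aeval scaleA (eta d ths i) As) xid) = act (X i) xi0 \<and>
       act (scaleA (1 / alg_trace rho (E d * Es d))
           (\<Sum>r\<le>d. scaleA (1 / (\<Prod>k=d-r+1..d. vphi k))
               (X r * E d * Es d * aeval scaleA (eta d th r) A)))
         (act (aeval scaleA (eta d ths i) As) xid) = act (X i) xid \<and>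
       act (scaleA (poly (eta d th d) (th 0) / (\<Prod>k=1..d. vphi k) * (form xi0 xisd / form xid xisd))
           (\<Sum>r\<le>d. X (d - r) * E 0 * aeval scaleA (tau ths (d - r)) As))
         (act (aeval scaleA (eta d ths (d - i)) As) xid) = act (X i) xi0 \<and>
       act (scaleA (1 / alg_trace rho (E d * Es d))
           (\<Sum>r\<le>d. scaleA (1 / (\<Prod>k=d-r+1..d. vphi k))
               (X (d - r) * E d * Es d * aeval scaleA (eta d th r) A)))
         (act (aeval scaleA (eta d ths (d - i)) As) xid) = act (X i) xid)"
proof -
  interpret M: matrix_algebra_module scaleA scaleV act d rho
    by (intro matrix_algebra_module.intro assms)
  interpret L: leonard scaleA scaleV act d A th E As ths Es
    using assms(3,4) by (rule M.leonard_from_leonard_system)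
  interpret F: invariant_form scaleA scaleV act dag form
    using assms(2,5,8,9,10)
    by (intro invariant_form.intro invariant_form_axioms.intro)
  interpret rv: leonard scaleA scaleV act d A "\<lambda>i. th (d - i)" "\<lambda>i. E (d - i)" As ths Es
    by (rule L.reverse_leonard)

  have E0: "act (E 0) xi0 = xi0" and Ed: "act (E d) xid = xid"
    and Es0: "act (Es 0) xis0 = xis0" and Esd: "act (Es d) xisd = xisd"
    using assms(11,13,15,17) L.R.range_P L.D.range_P by auto
  have lE0: "\<exists>c. act (E 0) w = scaleV c xi0" and lEd: "\<exists>c. act (E d) w = scaleV c xid"
    and lEs0: "\<exists>c. act (Es 0) w = scaleV c xis0" and lEsd: "\<exists>c. act (Es d) w = scaleV c xisd" for w
    using L.R.on_line[OF _ E0 assms(12)] L.R.on_line[OF _ Ed assms(14)]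
      L.D.on_line[OF _ Es0 assms(16)] L.D.on_line[OF _ Esd assms(18)] by auto
  have par: "E i = prim_idempotent scaleA scaleV act A (th i)"
    "Es i = prim_idempotent scaleA scaleV act As (ths i)" if "i \<le> d" for i
    using assms(4) that by (auto simp: parameter_array_def)
  have dagEs: "dag (Es i) = Es i" if "i \<le> d" for i
    using par(2)[OF that] F.dag_prim_idempotent[OF assms(7)] by metis
  note proj0 = F.act_rank_one_projection[OF dagEs Es0 assms(16) lEs0, simplified]
  note projd = F.act_rank_one_projection[OF dagEs Esd assms(18) lEsd, simplified]
  have form00: "form xis0 xis0 \<noteq> 0" and formdd: "form xisd xisd \<noteq> 0"
    using F.form_self_nonzero[OF dagEs Es0 assms(16) lEs0]
      F.form_self_nonzero[OF dagEs Esd assms(18) lEsd] by auto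
  have "act A xid = scaleV (th d) xid" using L.R.eigen[of d xid] Ed by simp
  then have "act (Es 0) xid \<noteq> 0" and Esd_xid: "act (Es d) xid \<noteq> 0"
    using L.eigenvector_end_components_nonzero assms(14) by blast+
  then have formd0: "form xid xis0 \<noteq> 0" and formdsd: "form xid xisd \<noteq> 0"
    using proj0[of xid] projd[of xid] by auto

  define w where "w i = act (aeval scaleA (eta d ths i) As) xid" for i
  define s where "s k = alg_trace rho (aeval scaleA (tau th k) A * Es 0)" for k
  define s' where "s' k = alg_trace rho (aeval scaleA (eta d th k) A * Es 0)" for k
  have s: "act (Es 0) (act (aeval scaleA (tau th k) A) xis0) = scaleV (s k) xis0" for k
    unfolding s_def by (rule M.trace_on_line[OF Es0 lEs0])
  have s': "act (Es 0) (act (aeval scaleA (eta d th k) A) xis0) = scaleV (s' k) xis0" for k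
    unfolding s'_def by (rule M.trace_on_line[OF Es0 lEs0])
  have vphi: "vphi k = (ths 0 - ths k) * (s k / s (k - 1))" if "1 \<le> k" "k \<le> d" for k
    using assms(4) that by (simp add: parameter_array_def s_def)
  have phi: "phi k = (ths 0 - ths k) * (s' k / s' (k - 1))" if "1 \<le> k" "k \<le> d" for k
    using assms(4) that by (simp add: parameter_array_def s'_def)
  have vphi_nz: "vphi k \<noteq> 0" if "1 \<le> k" "k \<le> d" for k
    using L.vphi_nonzero[OF Es0 assms(16) s vphi that] .
  have phi_nz: "phi k \<noteq> 0" if "1 \<le> k" "k \<le> d" for k
    using rv.vphi_nonzero[OF Es0 assms(16) s'[unfolded eta_eq_tau] phi that] .
  have prod_vphi: "(\<Prod>k=1..d. vphi k) \<noteq> 0" and prod_phi: "(\<Prod>k=1..d. phi k) \<noteq> 0"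
    and prod_vphi_tail: "(\<Prod>k=Suc (d-r)..d. vphi k) \<noteq> 0" for r
    using vphi_nz phi_nz by (auto simp: prod_zero_iff)
  let ?e = "poly (eta d th d) (th 0)"

  have pair_E0: "act (E 0) (act (aeval scaleA (tau ths (d - r)) As) (w i)) =
      (if r = i then act (E 0) (w d) else 0)" if "i \<le> d" "r \<le> d" for i r
    unfolding w_def using L.split_dual_pairing[OF Ed that] .
  have pair_Esd: "act (Es d) (act (aeval scaleA (eta d th r) A) (w i)) =
      (if r = i then scaleV (\<Prod>k=d-i+1..d. vphi k) (act (Es d) xid) else 0)" if "i \<le> d" "r \<le> d" for i r
    unfolding w_def using L.split_pairing[OF Es0 assms(16) s vphi Ed that] .

  \<comment> \<open>Apply \<open>E\<^sup>*\<^sub>d \<eta>\<^sub>d(A)\<close> to \<open>w d\<close>: once through \<open>\<eta>\<^sub>d(A) = \<eta>\<^sub>d(\<theta>\<^sub>0) E\<^sub>0\<close>, once through duality.\<close>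
  have scaled_E0: "scaleV (?e / (\<Prod>k=1..d. vphi k) * (form xi0 xisd / form xid xisd)) (act (E 0) (w d)) = xi0"
  proof -
    obtain c where c: "act (E 0) (w d) = scaleV c xi0" using lE0 by blast
    have "scaleV ?e (act (Es d) (act (E 0) (w d))) = scaleV (\<Prod>k=1..d. vphi k) (act (Es d) xid)"
      using pair_Esd[of d d] by (simp add: L.R.aeval_eta_top M.act_scale_right)
    then have "scaleV (?e * c * form xi0 xisd / form xisd xisd) xisd =
        scaleV ((\<Prod>k=1..d. vphi k) * form xid xisd / form xisd xisd) xisd"
      by (simp add: c M.act_scale_right projd mult.assoc)
    then have "?e * c * form xi0 xisd = (\<Prod>k=1..d. vphi k) * form xid xisd"
      using assms(18) formdd by simp
    then have "?e / (\<Prod>k=1..d. vphi k) * (form xi0 xisd / form xid xisd) * c = 1"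
      using prod_vphi formdsd by (simp add: divide_simps mult_ac)
    then show ?thesis by (simp add: c)
  qed

  \<comment> \<open>Here \<open>w d\<close> is a multiple of \<open>\<xi>\<^sup>*\<^sub>0\<close>, since \<open>\<eta>\<^sup>*\<^sub>d(A\<^sup>*) = \<eta>\<^sup>*\<^sub>d(\<theta>\<^sup>*\<^sub>0) E\<^sup>*\<^sub>0\<close>, and the product of
    the \<open>phi k\<close> telescopes to \<open>\<eta>\<^sup>*\<^sub>d(\<theta>\<^sup>*\<^sub>0) tr(\<eta>\<^sub>d(A) E\<^sup>*\<^sub>0)\<close>.\<close>
  have scaled_Es0_E0: "scaleV (?e / (\<Prod>k=1..d. phi k) * (form xis0 xis0 / form xid xis0))
      (act (Es 0) (act (E 0) (w d))) = xis0"
  proof -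
    have nz: "s' k \<noteq> 0" if "k < d" for k
      using rv.tau_A_bottom_nonzero[OF Es0 assms(16), of k] s'[of k] that by (auto simp: eta_eq_tau)
    have "scaleV (s' 0) xis0 = scaleV 1 xis0"
      using s'[of 0] Es0 by (simp add: eta_def M.act_aeval[of _ 0] M.act_one)
    then have s'0: "s' 0 = 1" using assms(16) by (simp only: M.space.scale_right_imp_eq) 
    have "(\<Prod>k=1..d. phi k) = (\<Prod>k=1..d. (ths 0 - ths k) * (s' k / s' (k - 1)))"
      by (intro prod.cong) (auto simp: phi)
    also have "\<dots> = poly (eta d ths d) (ths 0) * s' d"
      unfolding L.D.poly_eta_top by (rule prod_ratio_telescope[of d s', OF nz s'0])
    finally have ph: "(\<Prod>k=1..d. phi k) = poly (eta d ths d) (ths 0) * s' d" .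
    have sd: "scaleV ?e (act (Es 0) (act (E 0) xis0)) = scaleV (s' d) xis0"
      using s'[of d] by (simp add: L.R.aeval_eta_top M.act_scale_right)
    have wd: "w d = scaleV (poly (eta d ths d) (ths 0) * (form xid xis0 / form xis0 xis0)) xis0"
      by (simp add: w_def L.D.aeval_eta_top proj0)
    have "scaleV ?e (act (Es 0) (act (E 0) (w d))) =
        scaleV (poly (eta d ths d) (ths 0) * (form xid xis0 / form xis0 xis0))
          (scaleV ?e (act (Es 0) (act (E 0) xis0)))"
      by (simp add: wd M.act_scale_right mult_ac)
    also have "\<dots> = scaleV ((\<Prod>k=1..d. phi k) * (form xid xis0 / form xis0 xis0)) xis0"
      by (simp add: sd ph[simplified] mult_ac)
    finally have main: "scaleV ?e (act (Es 0) (act (E 0) (w d))) = \<dots>" .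
    have "scaleV (?e / (\<Prod>k=1..d. phi k) * (form xis0 xis0 / form xid xis0))
        (act (Es 0) (act (E 0) (w d))) =
      scaleV (1 / (\<Prod>k=1..d. phi k) * (form xis0 xis0 / form xid xis0))
        (scaleV ?e (act (Es 0) (act (E 0) (w d))))"
      by (simp add: mult_ac)
    also have "\<dots> = xis0"
      unfolding main using prod_phi formd0 form00 by simp
    finally show ?thesis .
  qed

  have scaled_Esd: "scaleV (form xisd xisd / form xid xisd) (act (Es d) xid) = xisd"
    using formdd formdsd by (simp add: projd)

  have scaled_Ed_Esd: "scaleV (1 / alg_trace rho (E d * Es d)) (act (E d) (act (Es d) xid)) = xid"
  proof -
    have tr: "act (E d) (act (Es d) xid) = scaleV (alg_trace rho (Es d * E d)) xid"
      by (rule M.trace_on_line[OF Ed lEd])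
    have eig: "act As (act (Es d) xid) = scaleV (ths d) (act (Es d) xid)" by (rule L.D.eigen) simp
    have "act (E d) (act (Es d) xid) \<noteq> 0"
      using rv.dual_eigenvector_first_component[OF eig Esd_xid] by simp
    then show ?thesis by (simp add: tr M.alg_trace_commute[of "E d"])
  qed

  have Es0_E0_sum: "act (scaleA (?e / (\<Prod>k=1..d. phi k) * (form xis0 xis0 / form xid xis0))
      (\<Sum>r\<le>d. X r * Es 0 * E 0 * aeval scaleA (tau ths (d - r)) As)) (w i) = act (X i) xis0"
    if "i \<le> d" for X i
    unfolding mult.assoc
    by (rule M.act_selected_summand[OF that _ scaled_Es0_E0]) (simp add: M.act_mult pair_E0 that)
  have Esd_sum: "act (scaleA (form xisd xisd / form xid xisd)
      (\<Sum>r\<le>d. scaleA (1 / (\<Prod>k=d-r+1..d. vphi k)) (X r * Es d * aeval scaleA (eta d th r) A)))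
        (w i) = act (X i) xisd" if "i \<le> d" for X i
    unfolding mult.assoc M.scale_mult_right[symmetric]
    by (rule M.act_selected_summand[OF that _ scaled_Esd])
      (simp add: M.act_mult M.act_scale_left M.act_scale_right pair_Esd that prod_vphi_tail del: prod_zero_iff)
  have E0_sum: "act (scaleA (?e / (\<Prod>k=1..d. vphi k) * (form xi0 xisd / form xid xisd))
      (\<Sum>r\<le>d. X r * E 0 * aeval scaleA (tau ths (d - r)) As)) (w i) = act (X i) xi0"
    if "i \<le> d" for X i
    unfolding mult.assoc
    by (rule M.act_selected_summand[OF that _ scaled_E0]) (simp add: M.act_mult pair_E0 that)
  have Ed_Esd_sum: "act (scaleA (1 / alg_trace rho (E d * Es d))
      (\<Sum>r\<le>d. scaleA (1 / (\<Prod>k=d-r+1..d. vphi k)) (X r * E d * Es d * aeval scaleA (eta d th r) A)))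
        (w i) = act (X i) xid" if "i \<le> d" for X i
    unfolding mult.assoc M.scale_mult_right[symmetric]
    by (rule M.act_selected_summand[OF that _ scaled_Ed_Esd])
      (simp add: M.act_mult M.act_scale_left M.act_scale_right pair_Esd that prod_vphi_tail del: prod_zero_iff)
  \<comment> \<open>Reversing both \<open>X\<close> and the index of \<open>w\<close> yields the remaining identities.\<close>
  have reversed: "act (scaleA c (\<Sum>r\<le>d. f r (X (d - r)))) (w (d - i)) = act (X i) z"
    if S: "\<And>Y j. j \<le> d \<Longrightarrow> act (scaleA c (\<Sum>r\<le>d. f r (Y r))) (w j) = act (Y j) z" and "i \<le> d"
    for c z X i and f :: "nat \<Rightarrow> 'a \<Rightarrow> 'a"
    using S[of "d - i" "\<lambda>r. X (d - r)"] that(2) by simp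
  note Es0_E0_sum' = reversed[of _ "\<lambda>r x. x * Es 0 * E 0 * aeval scaleA (tau ths (d - r)) As", OF Es0_E0_sum]
  note Esd_sum' = reversed[of _ "\<lambda>r x. scaleA (1 / (\<Prod>k=d-r+1..d. vphi k)) (x * Es d * aeval scaleA (eta d th r) A)", OF Esd_sum]
  note E0_sum' = reversed[of _ "\<lambda>r x. x * E 0 * aeval scaleA (tau ths (d - r)) As", OF E0_sum]
  note Ed_Esd_sum' = reversed[of _ "\<lambda>r x. scaleA (1 / (\<Prod>k=d-r+1..d. vphi k)) (x * E d * Es d * aeval scaleA (eta d th r) A)", OF Ed_Esd_sum]
  show ?thesis
    unfolding w_def[symmetric]
    by (intro conjI ballI allI impI Es0_E0_sum Esd_sum Es0_E0_sum' Esd_sum' E0_sum Ed_Esd_sum E0_sum' Ed_Esd_sum')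
qed

end
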